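(* Let $\Omega$ be a finite set, $\beta>0$, $H:\Omega\to\mathbb R$, and let $G$ be a finite set of maps $\Omega\to\Omega$ such that $\sigma\sigma\eta=\eta$ and $\sigma\gamma\eta=\gamma\sigma\eta$ for all $\eta\in\Omega$, $\sigma,\gamma\in G$. Let $\mathcal L$ be the generator with rates $$c(\eta,\sigma)=\exp\Big(-\frac\beta2\nabla_\sigma H(\eta)\Big),$$ and assume that $\mathcal L$ is irreducible. Set $$\kappa(\eta,\sigma):=c(\sigma\eta,\sigma)-\sum_{\gamma\in G,\ \gamma\ne\sigma}\max\{-\nabla_\sigma c(\eta,\gamma),0\}$$ and assume that $\kappa(\eta,\sigma)\ge0$ for all $\eta\in\Omega$, $\sigma\in G$. Define $$\kappa=\inf_{\eta\in\Omega,\sigma\in G}\big(\kappa(\eta,\sigma)+\kappa(\sigma\eta,\sigma)\big),\qquad\bar\kappa=\inf_{\eta\in\Omega,\sigma\in G}\kappa(\eta,\sigma).$$ Then: (i) for every admissible $\phi$ the convex Sobolev inequality holds with $\kappa_\phi=\kappa$; (ii) the modified logarithmic Sobolev inequality holds with $\kappa_1=\kappa+2\bar\kappa$; (iii) for every $\alpha\in(1,2]$ the Beckner inequality holds with $\kappa_\alpha=\alpha\kappa$.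
   Context: $\nabla_\sigma f(\eta)=f(\sigma\eta)-f(\eta)$, $\nabla_\sigma c(\eta,\gamma)=c(\sigma\eta,\gamma)-c(\eta,\gamma)$, and $\mathcal Lf(\eta)=\sum_{\sigma\in G}c(\eta,\sigma)\nabla_\sigma f(\eta)$. The reversible probability measure is the Gibbs measure $\mathbf m(\eta)=\frac1{Z_\beta}\exp(-\beta H(\eta))$. $\phi:[0,\infty)\to[0,\infty)$ is admissible if it is convex, twice differentiable on $(0,\infty)$, and $\Phi(a,b):=(\phi'(b)-\phi'(a))(b-a)$ is convex on $(0,\infty)^2$. $\mathcal H^\phi(f|\mathbf m)=\sum_\eta\phi(f(\eta))\mathbf m(\eta)-\phi\big(\sum_\eta f(\eta)\mathbf m(\eta)\big)$. The convex Sobolev inequality with constant $\kappa_\phi$ is: for all $f:\Omega\to(0,\infty)$, $$\kappa_\phi\,\mathcal H^\phi(f|\mathbf m)\le\frac12\sum_{\eta\in\Omega,\sigma\in G}c(\eta,\sigma)\,\Phi(f(\eta),f(\sigma\eta))\,\mathbf m(\eta).$$ Let $\phi_1(a)=a\log a-a+1$ and $\phi_\alpha(a)=\frac{1}{\alpha-1}(a^\alpha-a)-a+1$ for $\alpha\in(1,2]$. The modified logarithmic Sobolev inequality with constant $\kappa_1$ is the convex Sobolev inequality for $\phi=\phi_1$; the Beckner inequality with constant $\kappa_\alpha$ is the one for $\phi=\phi_\alpha$. *)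

theory Defs
  imports "HOL-Analysis.Analysis"
begin

text \<open>The finite state space is a type of class \<open>finite\<close>; moves are maps on it.\<close>

definition nabla :: "('a \<Rightarrow> 'a) \<Rightarrow> ('a \<Rightarrow> real) \<Rightarrow> 'a \<Rightarrow> real" where
  "nabla \<sigma> f \<eta> = f (\<sigma> \<eta>) - f \<eta>"

definition generator ::
    "('a \<Rightarrow> 'a) set \<Rightarrow> ('a \<Rightarrow> ('a \<Rightarrow> 'a) \<Rightarrow> real) \<Rightarrow> ('a \<Rightarrow> real) \<Rightarrow> 'a \<Rightarrow> real" where
  "generator G c f \<eta> = (\<Sum>\<sigma>\<in>G. c \<eta> \<sigma> * nabla \<sigma> f \<eta>)"

text \<open>For \<open>\<eta> \<noteq> \<eta>'\<close> the jump rate from \<open>\<eta>\<close> to \<open>\<eta>'\<close> is the matrix entry of the generator,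
  obtained by applying it to the indicator function of \<open>\<eta>'\<close>.\<close>

definition irreducible_generator :: "(('a \<Rightarrow> real) \<Rightarrow> 'a \<Rightarrow> real) \<Rightarrow> bool" where
  "irreducible_generator L \<longleftrightarrow>
     (\<forall>\<eta> \<eta>'. (\<eta>, \<eta>') \<in> {(x, y). x \<noteq> y \<and> L (indicator {y}) x > 0}\<^sup>*)"

definition glauber_rate :: "real \<Rightarrow> ('a \<Rightarrow> real) \<Rightarrow> 'a \<Rightarrow> ('a \<Rightarrow> 'a) \<Rightarrow> real" where
  "glauber_rate \<beta> H \<eta> \<sigma> = exp (- (\<beta> / 2) * nabla \<sigma> H \<eta>)"

definition partition_function :: "real \<Rightarrow> ('a::finite \<Rightarrow> real) \<Rightarrow> real" where
  "partition_function \<beta> H = (\<Sum>\<eta>\<in>UNIV. exp (- \<beta> * H \<eta>))"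

definition gibbs :: "real \<Rightarrow> ('a::finite \<Rightarrow> real) \<Rightarrow> 'a \<Rightarrow> real" where
  "gibbs \<beta> H \<eta> = 1 / partition_function \<beta> H * exp (- \<beta> * H \<eta>)"

text \<open>Functions on \<open>[0, \<infinity>)\<close> are represented by total functions on the reals; nothing below
  depends on their values at negative arguments.\<close>

definition Phi :: "(real \<Rightarrow> real) \<Rightarrow> real \<Rightarrow> real \<Rightarrow> real" where
  "Phi \<phi> a b = (deriv \<phi> b - deriv \<phi> a) * (b - a)"

definition admissible :: "(real \<Rightarrow> real) \<Rightarrow> bool" where
  "admissible \<phi> \<longleftrightarrow>
     (\<forall>x\<ge>0. \<phi> x \<ge> 0) \<and>
     convex_on {0..} \<phi> \<and>
     (\<forall>x>0. \<phi> differentiable (at x)) \<and>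
     (\<forall>x>0. deriv \<phi> differentiable (at x)) \<and>
     convex_on ({0<..} \<times> {0<..}) (\<lambda>(a, b). Phi \<phi> a b)"

definition phi_entropy :: "(real \<Rightarrow> real) \<Rightarrow> ('a::finite \<Rightarrow> real) \<Rightarrow> ('a \<Rightarrow> real) \<Rightarrow> real" where
  "phi_entropy \<phi> f m = (\<Sum>\<eta>\<in>UNIV. \<phi> (f \<eta>) * m \<eta>) - \<phi> (\<Sum>\<eta>\<in>UNIV. f \<eta> * m \<eta>)"

definition convex_Sobolev ::
    "('a::finite \<Rightarrow> 'a) set \<Rightarrow> ('a \<Rightarrow> ('a \<Rightarrow> 'a) \<Rightarrow> real) \<Rightarrow> ('a \<Rightarrow> real) \<Rightarrow> (real \<Rightarrow> real) \<Rightarrow> real \<Rightarrow> bool"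
  where
  "convex_Sobolev G c m \<phi> k \<longleftrightarrow>
     (\<forall>f. (\<forall>\<eta>. f \<eta> > 0) \<longrightarrow>
       k * phi_entropy \<phi> f m
         \<le> 1 / 2 * (\<Sum>(\<eta>, \<sigma>)\<in>UNIV \<times> G. c \<eta> \<sigma> * Phi \<phi> (f \<eta>) (f (\<sigma> \<eta>)) * m \<eta>))"

definition phi_log :: "real \<Rightarrow> real" where
  "phi_log a = a * ln a - a + 1"

definition phi_pow :: "real \<Rightarrow> real \<Rightarrow> real" where
  "phi_pow \<alpha> a = 1 / (\<alpha> - 1) * (a powr \<alpha> - a) - a + 1"

definition modified_log_Sobolev ::
    "('a::finite \<Rightarrow> 'a) set \<Rightarrow> ('a \<Rightarrow> ('a \<Rightarrow> 'a) \<Rightarrow> real) \<Rightarrow> ('a \<Rightarrow> real) \<Rightarrow> real \<Rightarrow> bool" where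
  "modified_log_Sobolev G c m k \<longleftrightarrow> convex_Sobolev G c m phi_log k"

definition Beckner ::
    "('a::finite \<Rightarrow> 'a) set \<Rightarrow> ('a \<Rightarrow> ('a \<Rightarrow> 'a) \<Rightarrow> real) \<Rightarrow> ('a \<Rightarrow> real) \<Rightarrow> real \<Rightarrow> real \<Rightarrow> bool" where
  "Beckner G c m \<alpha> k \<longleftrightarrow> convex_Sobolev G c m (phi_pow \<alpha>) k"

definition kappa ::
    "('a \<Rightarrow> 'a) set \<Rightarrow> ('a \<Rightarrow> ('a \<Rightarrow> 'a) \<Rightarrow> real) \<Rightarrow> 'a \<Rightarrow> ('a \<Rightarrow> 'a) \<Rightarrow> real" where
  "kappa G c \<eta> \<sigma> =
     c (\<sigma> \<eta>) \<sigma> - (\<Sum>\<gamma>\<in>G - {\<sigma>}. max (- nabla \<sigma> (\<lambda>\<xi>. c \<xi> \<gamma>) \<eta>) 0)"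

text \<open>For \<open>G = {}\<close> the two infima below are unspecified reals. Irreducibility then forces a
  one-point state space, where the entropy vanishes and their values do not matter.\<close>

definition kappa_inf :: "('a \<Rightarrow> 'a) set \<Rightarrow> ('a \<Rightarrow> ('a \<Rightarrow> 'a) \<Rightarrow> real) \<Rightarrow> real" where
  "kappa_inf G c = (INF (\<eta>, \<sigma>)\<in>UNIV \<times> G. kappa G c \<eta> \<sigma> + kappa G c (\<sigma> \<eta>) \<sigma>)"

definition kappa_bar :: "('a \<Rightarrow> 'a) set \<Rightarrow> ('a \<Rightarrow> ('a \<Rightarrow> 'a) \<Rightarrow> real) \<Rightarrow> real" where
  "kappa_bar G c = (INF (\<eta>, \<sigma>)\<in>UNIV \<times> G. kappa G c \<eta> \<sigma>)"

end

theory Submission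
  imports Defs
begin

text \<open>
  Let \<open>E(f)\<close> be the right-hand side of the convex Sobolev inequality. Its derivative in direction
  \<open>\<L>f\<close> is bounded by \<open>- K E(f)\<close> using a coupling of the dynamics started in \<open>\<eta>\<close> and \<open>\<sigma>\<eta>\<close>.
  For \<open>\<gamma> \<noteq> \<sigma>\<close> both copies perform \<open>\<gamma>\<close> at the smaller of the two rates; when only one of them
  performs \<open>\<gamma>\<close>, the other one performs \<open>\<sigma>\<close>, so the copies are neighbours again. What remains
  of the rate of \<open>\<sigma>\<close> is \<open>\<kappa>\<close> and merges the copies. A supporting plane of \<open>\<Phi>\<close> bounds the
  derivative by the rate of change of \<open>\<Phi>\<close> along this coupling, and all contributions except the
  merging ones cancel after summation. For the logarithmic and power entropies the merging terms
  are computed exactly, which gives the better constants.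

  Instead of integrating along the semigroup, take \<open>k < K\<close> and minimise \<open>J = E - k \<H>\<close> over all
  functions with values in \<open>[min f, max f]\<close>. A small step along \<open>\<L>\<close> stays in this compact set,
  so at a minimiser the derivative of \<open>J\<close> in direction \<open>\<L>h\<close> is nonnegative, while it is at most
  \<open>(k - K) E(h)\<close>. Hence \<open>E(h) = 0\<close>, irreducibility gives \<open>\<H>(h) = 0\<close>, and \<open>J \<ge> 0\<close>.
\<close>

text \<open>The partial derivative of \<open>Phi \<phi>\<close> in the first argument; by symmetry \<open>dPhi \<phi> b a\<close> is the one
  in the second argument at \<open>(a, b)\<close>.\<close>

definition dPhi :: "(real \<Rightarrow> real) \<Rightarrow> real \<Rightarrow> real \<Rightarrow> real" where
  "dPhi \<phi> a b = deriv \<phi> a - deriv \<phi> b - deriv (deriv \<phi>) a * (b - a)"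

section \<open>Derivatives and supporting planes of \<open>Phi\<close>\<close>

lemma Phi_sym: "Phi \<phi> a b = Phi \<phi> b a"
  by (simp add: Phi_def algebra_simps)

lemma Phi_diag [simp]: "Phi \<phi> a a = 0"
  by (simp add: Phi_def)

lemma convex_positive_line: "convex {t::real. a + t * u > 0 \<and> b + t * v > 0}"
proof -
  have "convex ({t. u \<bullet> t > - a} \<inter> {t. v \<bullet> t > - b})"
    by (intro convex_Int convex_halfspace_gt)
  also have "{t. u \<bullet> t > - a} \<inter> {t. v \<bullet> t > - b} = {t. a + t * u > 0 \<and> b + t * v > 0}"
    by (auto simp: mult.commute)
  finally show ?thesis .
qed

lemma convex_on_eq:
  assumes f: "convex_on A f" and eq: "\<And>x. x \<in> A \<Longrightarrow> g x = f x"
  shows "convex_on A g"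
proof (rule convex_onI)
  show "convex A" using f by (rule convex_on_imp_convex)
  then show "g ((1 - t) *\<^sub>R x + t *\<^sub>R y) \<le> (1 - t) * g x + t * g y"
    if "0 < t" "t < 1" "x \<in> A" "y \<in> A" for t x y
    using convex_onD[OF f, of t x y] that by (simp add: eq convex_alt)
qed

text \<open>Differentiability is kept apart from convexity, so that the derivative formulas are
  available while the supporting planes of a concrete entropy are still being established.\<close>

locale smooth_entropy =
  fixes \<phi> :: "real \<Rightarrow> real"
  assumes DERIV_phi: "x > 0 \<Longrightarrow> (\<phi> has_real_derivative deriv \<phi> x) (at x)"
    and DERIV_deriv_phi:
      "x > 0 \<Longrightarrow> (deriv \<phi> has_real_derivative deriv (deriv \<phi>) x) (at x)"
begin

lemma DERIV_phi_line:
  assumes "x > 0"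
  shows "((\<lambda>t. \<phi> (x + t * u)) has_real_derivative deriv \<phi> x * u) (at 0)"
  by (rule DERIV_chain2[where g = "\<lambda>t. x + t * u"])
    (auto intro!: derivative_eq_intros DERIV_phi simp: assms)

lemma DERIV_deriv_phi_line:
  assumes "x > 0"
  shows "((\<lambda>t. deriv \<phi> (x + t * u)) has_real_derivative deriv (deriv \<phi>) x * u) (at 0)"
  by (rule DERIV_chain2[where g = "\<lambda>t. x + t * u"])
    (auto intro!: derivative_eq_intros DERIV_deriv_phi simp: assms)

lemma DERIV_Phi_line:
  assumes "a > 0" "b > 0"
  shows "((\<lambda>t. Phi \<phi> (a + t * u) (b + t * v)) has_real_derivative
    dPhi \<phi> a b * u + dPhi \<phi> b a * v) (at 0)"
  unfolding Phi_def
  by (rule derivative_eq_intros DERIV_deriv_phi_line assms refl)+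
    (simp add: dPhi_def algebra_simps)

lemma support_of_convex:
  assumes "convex_on {0<..} \<phi>" "x > 0" "y > 0"
  shows "\<phi> x + deriv \<phi> x * (y - x) \<le> \<phi> y"
  using convex_on_imp_above_tangent[OF assms(1), of x y "deriv \<phi> x"] assms
    DERIV_subset[OF DERIV_phi, of x "{0<..}"]
  by (simp add: interior_open)

text \<open>The tangent at t = 0 of the restriction to the line from (a, b) to (x, y), evaluated at
  t = 1. Convexity is asked for along this line only, which a second derivative in one variable can
  verify.\<close>

lemma Phi_support_of_convex:
  assumes conv: "convex_on {t. a + t * (x - a) > 0 \<and> b + t * (y - b) > 0}
      (\<lambda>t. Phi \<phi> (a + t * (x - a)) (b + t * (y - b)))" (is "convex_on ?A ?g")
    and pos: "a > 0" "b > 0" "x > 0" "y > 0"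
  shows "Phi \<phi> a b + dPhi \<phi> a b * (x - a) + dPhi \<phi> b a * (y - b) \<le> Phi \<phi> x y"
proof -
  have A: "?A = {t. 0 < a + t * (x - a)} \<inter> {t. 0 < b + t * (y - b)}" by auto
  have "open ?A"
    unfolding A by (intro open_Int open_Collect_less continuous_intros)
  moreover have "connected ?A"
    by (intro convex_connected convex_positive_line)
  ultimately have "?g 1 - ?g 0 \<ge> (dPhi \<phi> a b * (x - a) + dPhi \<phi> b a * (y - b)) * (1 - 0)"
    using pos DERIV_Phi_line[OF pos(1,2), of "x - a" "y - b"]
    by (intro convex_on_imp_above_tangent[OF conv])
      (auto simp: interior_open intro: DERIV_subset)
  then show ?thesis by simp
qed

end

text \<open>Differentiating \<open>deriv \<phi>\<close> requires its closed form on a neighbourhood,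
  hence the transfer within the open half-line.\<close>

lemma smooth_entropyI:
  assumes d1: "\<And>x. x > 0 \<Longrightarrow> (\<phi> has_real_derivative \<psi> x) (at x)"
    and d2: "\<And>x. x > 0 \<Longrightarrow> (\<psi> has_real_derivative \<psi>' x) (at x)"
  shows "smooth_entropy \<phi>"
    and "x > 0 \<Longrightarrow> deriv \<phi> x = \<psi> x"
    and "x > 0 \<Longrightarrow> deriv (deriv \<phi>) x = \<psi>' x"
proof -
  have 1: "deriv \<phi> x = \<psi> x" if "x > 0" for x
    using d1[OF that] by (rule DERIV_imp_deriv)
  have 2: "(deriv \<phi> has_real_derivative \<psi>' x) (at x)" if "x > 0" for x
    by (rule has_field_derivative_transform_within_open[OF d2[OF that], of "{0<..}"])
      (use that 1 in auto)
  show "x > 0 \<Longrightarrow> deriv \<phi> x = \<psi> x" "x > 0 \<Longrightarrow> deriv (deriv \<phi>) x = \<psi>' x"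
    using 1 DERIV_imp_deriv[OF 2] by auto
  show "smooth_entropy \<phi>"
    by standard (use d1 1 2 DERIV_imp_deriv[OF 2] in auto)
qed

text \<open>Convexity enters the coupling argument through these tangent inequalities. Admissibility
  implies them; for the logarithmic and power entropies they are proved directly.\<close>

locale supported_entropy = smooth_entropy +
  assumes support: "x > 0 \<Longrightarrow> y > 0 \<Longrightarrow> \<phi> x + deriv \<phi> x * (y - x) \<le> \<phi> y"
    and Phi_support: "\<lbrakk>a > 0; b > 0; x > 0; y > 0\<rbrakk> \<Longrightarrow>
      Phi \<phi> a b + dPhi \<phi> a b * (x - a) + dPhi \<phi> b a * (y - b) \<le> Phi \<phi> x y"
begin

text \<open>Adding the tangent inequalities at a and at b leaves exactly this.\<close>

lemma Phi_nonneg: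
  assumes "a > 0" "b > 0"
  shows "Phi \<phi> a b \<ge> 0"
  using support[OF assms] support[OF assms(2,1)] by (simp add: Phi_def algebra_simps)

end

section \<open>Commuting reversible dynamics and cancellations in the coupling\<close>

text \<open>\<open>path_independent\<close>: the two ways along the square from \<eta> to
  \<sigma>\<gamma>\<eta> have the same product of rates. With \<open>reversible\<close> it stands in
  for the explicit Hamiltonian.\<close>

locale commuting_glauber =
  fixes G :: "('a::finite \<Rightarrow> 'a) set"
    and c :: "'a \<Rightarrow> ('a \<Rightarrow> 'a) \<Rightarrow> real"
    and m :: "'a \<Rightarrow> real"
  assumes finite_G: "finite G"
    and involution: "\<sigma> \<in> G \<Longrightarrow> \<sigma> (\<sigma> \<eta>) = \<eta>"
    and commute: "\<sigma> \<in> G \<Longrightarrow> \<gamma> \<in> G \<Longrightarrow> \<sigma> (\<gamma> \<eta>) = \<gamma> (\<sigma> \<eta>)"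
    and c_pos: "c \<eta> \<sigma> > 0"
    and m_pos: "m \<eta> > 0"
    and m_sum: "(\<Sum>\<eta>\<in>UNIV. m \<eta>) = 1"
    and reversible: "\<sigma> \<in> G \<Longrightarrow> m (\<sigma> \<eta>) * c (\<sigma> \<eta>) \<sigma> = m \<eta> * c \<eta> \<sigma>"
    and path_independent:
      "\<sigma> \<in> G \<Longrightarrow> \<gamma> \<in> G \<Longrightarrow> c \<eta> \<gamma> * c (\<gamma> \<eta>) \<sigma> = c \<eta> \<sigma> * c (\<sigma> \<eta>) \<gamma>"
begin

text \<open>The Dirichlet form of f and \<phi>'(f).\<close>

definition energy :: "(real \<Rightarrow> real) \<Rightarrow> ('a \<Rightarrow> real) \<Rightarrow> real" where
  "energy \<phi> f = 1 / 2 * (\<Sum>\<eta>\<in>UNIV. \<Sum>\<sigma>\<in>G. m \<eta> * c \<eta> \<sigma> * Phi \<phi> (f \<eta>) (f (\<sigma> \<eta>)))"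

lemma convex_Sobolev_iff:
  "convex_Sobolev G c m \<phi> k \<longleftrightarrow>
    (\<forall>f. (\<forall>\<eta>. f \<eta> > 0) \<longrightarrow> k * phi_entropy \<phi> f m \<le> energy \<phi> f)"
  unfolding convex_Sobolev_def energy_def
  by (simp add: sum.cartesian_product mult_ac)

lemma weight_nonneg: "0 \<le> m \<eta> * c \<eta> \<sigma>"
  by (simp add: less_imp_le m_pos c_pos)

lemma sum_UNIV_move:
  assumes "\<sigma> \<in> G"
  shows "(\<Sum>\<eta>\<in>UNIV. g (\<sigma> \<eta>)) = (\<Sum>\<eta>\<in>UNIV. g \<eta> :: real)"
  by (rule sum.reindex_bij_witness[of _ \<sigma> \<sigma>]) (auto simp: involution assms)

text \<open>For copies at \<eta> and \<sigma>\<eta>: the rate at which both perform \<gamma>. What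
  is left of the rate of \<gamma> at \<eta> is \<open>surplus\<close>.\<close>

abbreviation joint :: "'a \<Rightarrow> ('a \<Rightarrow> 'a) \<Rightarrow> ('a \<Rightarrow> 'a) \<Rightarrow> real" where
  "joint \<eta> \<sigma> \<gamma> \<equiv> min (c \<eta> \<gamma>) (c (\<sigma> \<eta>) \<gamma>)"

abbreviation surplus :: "'a \<Rightarrow> ('a \<Rightarrow> 'a) \<Rightarrow> ('a \<Rightarrow> 'a) \<Rightarrow> real" where
  "surplus \<eta> \<sigma> \<gamma> \<equiv> max (c \<eta> \<gamma> - c (\<sigma> \<eta>) \<gamma>) 0"

text \<open>Each one-sided \<gamma> of the copy at \<eta> uses up some of the rate of \<sigma> at
  \<sigma>\<eta>; the remainder is the rate at which the copy at \<sigma>\<eta> jumps alone onto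
  \<eta>.\<close>

lemma kappa_eq: "kappa G c \<eta> \<sigma> = c (\<sigma> \<eta>) \<sigma> - (\<Sum>\<gamma>\<in>G - {\<sigma>}. surplus \<eta> \<sigma> \<gamma>)"
  by (simp add: kappa_def nabla_def)

lemma kappa_move_eq:
  assumes "\<sigma> \<in> G"
  shows "kappa G c (\<sigma> \<eta>) \<sigma> = c \<eta> \<sigma> - (\<Sum>\<gamma>\<in>G - {\<sigma>}. max (c (\<sigma> \<eta>) \<gamma> - c \<eta> \<gamma>) 0)"
  by (simp add: kappa_eq involution assms)

text \<open>Reversibility and path independence turn each argument of the minimum at \<gamma>\<eta>
  into the other one at \<eta>, and the minimum is symmetric.\<close>

lemma joint_balance:
  assumes "\<sigma> \<in> G" "\<gamma> \<in> G"
  shows "m (\<gamma> \<eta>) * c (\<gamma> \<eta>) \<sigma> * joint (\<gamma> \<eta>) \<sigma> \<gamma> = m \<eta> * c \<eta> \<sigma> * joint \<eta> \<sigma> \<gamma>"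
proof -
  have pull: "x * y * min u v = min (x * y * u) (x * y * v)" if "x > 0" "y > 0" for x y u v :: real
    using that by (simp add: min_mult_distrib_left)
  have 1: "m (\<gamma> \<eta>) * c (\<gamma> \<eta>) \<sigma> * c (\<gamma> \<eta>) \<gamma> = m \<eta> * c \<eta> \<sigma> * c (\<sigma> \<eta>) \<gamma>"
    using reversible[OF assms(2), of \<eta>] path_independent[OF assms, of \<eta>]
    by (metis mult.assoc mult.commute)
  have "c (\<gamma> \<eta>) \<gamma> * c \<eta> \<sigma> = c (\<gamma> \<eta>) \<sigma> * c (\<sigma> (\<gamma> \<eta>)) \<gamma>"
    using path_independent[OF assms, of "\<gamma> \<eta>"] by (simp add: involution assms)
  then have 2: "m (\<gamma> \<eta>) * c (\<gamma> \<eta>) \<sigma> * c (\<sigma> (\<gamma> \<eta>)) \<gamma> = m \<eta> * c \<eta> \<sigma> * c \<eta> \<gamma>"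
    using reversible[OF assms(2), of \<eta>] by (metis mult.assoc mult.commute)
  show ?thesis
    unfolding pull[OF m_pos c_pos] 1 2 by (simp add: min.commute)
qed

text \<open>By path independence c(\<eta>,\<sigma>) (c(\<eta>,\<gamma>) -
  c(\<sigma>\<eta>,\<gamma>)) is symmetric in \<sigma> and \<gamma>.\<close>

lemma surplus_balance:
  assumes "\<sigma> \<in> G" "\<gamma> \<in> G"
  shows "m \<eta> * c \<eta> \<sigma> * surplus \<eta> \<sigma> \<gamma> = m \<eta> * c \<eta> \<gamma> * surplus \<eta> \<gamma> \<sigma>"
proof -
  have pull: "x * y * max u 0 = max (x * (y * u)) 0" if "x > 0" "y > 0" for x y u :: real
    using that by (simp add: max_mult_distrib_left mult.assoc)
  have "c \<eta> \<sigma> * (c \<eta> \<gamma> - c (\<sigma> \<eta>) \<gamma>) = c \<eta> \<gamma> * (c \<eta> \<sigma> - c (\<gamma> \<eta>) \<sigma>)"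
    using path_independent[OF assms, of \<eta>] by (simp add: algebra_simps)
  then show ?thesis
    unfolding pull[OF m_pos c_pos] by simp
qed

text \<open>The substitution of \<gamma>\<eta> for \<eta> carries the pair (\<eta>, \<sigma>\<eta>)
  to its image under \<gamma> and preserves the weight.\<close>

lemma sum_joint:
  assumes "\<sigma> \<in> G" "\<gamma> \<in> G"
  shows "(\<Sum>\<eta>\<in>UNIV. m \<eta> * c \<eta> \<sigma> * joint \<eta> \<sigma> \<gamma> * (g (\<gamma> \<eta>) (\<gamma> (\<sigma> \<eta>)) - g \<eta> (\<sigma> \<eta>))) = 0"
proof -
  have "(\<Sum>\<eta>\<in>UNIV. m \<eta> * c \<eta> \<sigma> * joint \<eta> \<sigma> \<gamma> * g \<eta> (\<sigma> \<eta>))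
      = (\<Sum>\<eta>\<in>UNIV. m (\<gamma> \<eta>) * c (\<gamma> \<eta>) \<sigma> * joint (\<gamma> \<eta>) \<sigma> \<gamma> * g (\<gamma> \<eta>) (\<sigma> (\<gamma> \<eta>)))"
    by (rule sum_UNIV_move[OF assms(2), symmetric])
  also have "\<dots> = (\<Sum>\<eta>\<in>UNIV. m \<eta> * c \<eta> \<sigma> * joint \<eta> \<sigma> \<gamma> * g (\<gamma> \<eta>) (\<gamma> (\<sigma> \<eta>)))"
    by (simp only: joint_balance[OF assms]) (simp only: commute[OF assms])
  finally show ?thesis
    by (simp add: right_diff_distrib sum_subtractf)
qed

lemma sum_off_diagonal_swap:
  "(\<Sum>\<sigma>\<in>G. \<Sum>\<gamma>\<in>G - {\<sigma>}. h \<sigma> \<gamma>) = (\<Sum>\<sigma>\<in>G. \<Sum>\<gamma>\<in>G - {\<sigma>}. h \<gamma> \<sigma> :: real)"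
  unfolding sum.Sigma[OF finite_G, of "\<lambda>\<sigma>. G - {\<sigma>}", OF ballI[OF finite_Diff[OF finite_G]]]
  by (rule sum.reindex_bij_witness[of _ prod.swap prod.swap]) auto

text \<open>The cancellation already happens for each fixed \<eta>: exchanging \<sigma> and \<gamma>
  preserves the weight and exchanges the pairs before and after the jump, up to order.\<close>

lemma sum_surplus:
  assumes sym: "\<And>x y. g x y = g y x"
  shows "(\<Sum>\<eta>\<in>UNIV. \<Sum>\<sigma>\<in>G. \<Sum>\<gamma>\<in>G - {\<sigma>}.
    m \<eta> * c \<eta> \<sigma> * surplus \<eta> \<sigma> \<gamma> * (g (\<gamma> \<eta>) \<eta> - g \<eta> (\<sigma> \<eta>))) = 0"
proof (rule sum.neutral, rule ballI)
  fix \<eta>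
  have "(\<Sum>\<sigma>\<in>G. \<Sum>\<gamma>\<in>G - {\<sigma>}. m \<eta> * c \<eta> \<sigma> * surplus \<eta> \<sigma> \<gamma> * g \<eta> (\<sigma> \<eta>))
      = (\<Sum>\<sigma>\<in>G. \<Sum>\<gamma>\<in>G - {\<sigma>}. m \<eta> * c \<eta> \<gamma> * surplus \<eta> \<gamma> \<sigma> * g \<eta> (\<gamma> \<eta>))"
    by (rule sum_off_diagonal_swap)
  also have "\<dots> = (\<Sum>\<sigma>\<in>G. \<Sum>\<gamma>\<in>G - {\<sigma>}. m \<eta> * c \<eta> \<sigma> * surplus \<eta> \<sigma> \<gamma> * g (\<gamma> \<eta>) \<eta>)"
    by (intro sum.cong refl) (simp add: surplus_balance sym)
  finally show "(\<Sum>\<sigma>\<in>G. \<Sum>\<gamma>\<in>G - {\<sigma>}.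
      m \<eta> * c \<eta> \<sigma> * surplus \<eta> \<sigma> \<gamma> * (g (\<gamma> \<eta>) \<eta> - g \<eta> (\<sigma> \<eta>))) = 0"
    by (simp add: right_diff_distrib sum_subtractf)
qed

text \<open>The generator of the coupling without the merging jumps, applied to \<open>g\<close> at \<open>(\<eta>, \<sigma>\<eta>)\<close>: the
  contribution of the moves triggered by \<open>\<gamma>\<close>.\<close>

definition coupled :: "('a \<Rightarrow> 'a \<Rightarrow> real) \<Rightarrow> 'a \<Rightarrow> ('a \<Rightarrow> 'a) \<Rightarrow> ('a \<Rightarrow> 'a) \<Rightarrow> real" where
  "coupled g \<eta> \<sigma> \<gamma> =
     joint \<eta> \<sigma> \<gamma> * (g (\<gamma> \<eta>) (\<gamma> (\<sigma> \<eta>)) - g \<eta> (\<sigma> \<eta>))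
     + surplus \<eta> \<sigma> \<gamma> * (g (\<gamma> \<eta>) \<eta> - g \<eta> (\<sigma> \<eta>))
     + max (c (\<sigma> \<eta>) \<gamma> - c \<eta> \<gamma>) 0 * (g (\<sigma> \<eta>) (\<gamma> (\<sigma> \<eta>)) - g \<eta> (\<sigma> \<eta>))"

text \<open>The third kind of jump is the second one seen from \<sigma>\<eta>, with the same weight
  by reversibility, so \<open>sum_joint\<close> and \<open>sum_surplus\<close> cover all
  terms.\<close>

lemma sum_coupled:
  assumes sym: "\<And>x y. g x y = g y x"
  shows "(\<Sum>\<eta>\<in>UNIV. \<Sum>\<sigma>\<in>G. m \<eta> * c \<eta> \<sigma> * (\<Sum>\<gamma>\<in>G - {\<sigma>}. coupled g \<eta> \<sigma> \<gamma>)) = 0"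
proof -
  define A where "A \<eta> \<sigma> \<gamma> = m \<eta> * c \<eta> \<sigma> * joint \<eta> \<sigma> \<gamma> * (g (\<gamma> \<eta>) (\<gamma> (\<sigma> \<eta>)) - g \<eta> (\<sigma> \<eta>))"
    for \<eta> \<sigma> \<gamma>
  define B where "B \<eta> \<sigma> \<gamma> = m \<eta> * c \<eta> \<sigma> * surplus \<eta> \<sigma> \<gamma> * (g (\<gamma> \<eta>) \<eta> - g \<eta> (\<sigma> \<eta>))"
    for \<eta> \<sigma> \<gamma>
  have split: "m \<eta> * c \<eta> \<sigma> * coupled g \<eta> \<sigma> \<gamma> = A \<eta> \<sigma> \<gamma> + B \<eta> \<sigma> \<gamma> + B (\<sigma> \<eta>) \<sigma> \<gamma>"
    if "\<sigma> \<in> G" for \<eta> \<sigma> \<gamma>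
    unfolding A_def B_def coupled_def reversible[OF that] involution[OF that]
      sym[of "\<gamma> (\<sigma> \<eta>)" "\<sigma> \<eta>"] sym[of "\<sigma> \<eta>" \<eta>]
    by (simp add: distrib_left mult.assoc)
  have A0: "(\<Sum>\<eta>\<in>UNIV. \<Sum>\<sigma>\<in>G. \<Sum>\<gamma>\<in>G - {\<sigma>}. A \<eta> \<sigma> \<gamma>) = 0"
  proof -
    have "(\<Sum>\<eta>\<in>UNIV. \<Sum>\<sigma>\<in>G. \<Sum>\<gamma>\<in>G - {\<sigma>}. A \<eta> \<sigma> \<gamma>)
        = (\<Sum>\<sigma>\<in>G. \<Sum>\<gamma>\<in>G - {\<sigma>}. \<Sum>\<eta>\<in>UNIV. A \<eta> \<sigma> \<gamma>)"
      by (subst sum.swap) (intro sum.cong refl sum.swap)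
    also have "\<dots> = 0"
      by (simp add: A_def sum_joint)
    finally show ?thesis .
  qed
  have B0: "(\<Sum>\<eta>\<in>UNIV. \<Sum>\<sigma>\<in>G. \<Sum>\<gamma>\<in>G - {\<sigma>}. B \<eta> \<sigma> \<gamma>) = 0"
    unfolding B_def by (rule sum_surplus) (rule sym)
  have "(\<Sum>\<eta>\<in>UNIV. \<Sum>\<sigma>\<in>G. \<Sum>\<gamma>\<in>G - {\<sigma>}. B (\<sigma> \<eta>) \<sigma> \<gamma>)
      = (\<Sum>\<sigma>\<in>G. \<Sum>\<eta>\<in>UNIV. \<Sum>\<gamma>\<in>G - {\<sigma>}. B (\<sigma> \<eta>) \<sigma> \<gamma>)"
    by (rule sum.swap)
  also have "\<dots> = (\<Sum>\<sigma>\<in>G. \<Sum>\<eta>\<in>UNIV. \<Sum>\<gamma>\<in>G - {\<sigma>}. B \<eta> \<sigma> \<gamma>)"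
    by (intro sum.cong refl sum_UNIV_move)
  also have "\<dots> = 0"
    using B0 by (subst sum.swap)
  finally have C0: "(\<Sum>\<eta>\<in>UNIV. \<Sum>\<sigma>\<in>G. \<Sum>\<gamma>\<in>G - {\<sigma>}. B (\<sigma> \<eta>) \<sigma> \<gamma>) = 0" .
  have "(\<Sum>\<eta>\<in>UNIV. \<Sum>\<sigma>\<in>G. m \<eta> * c \<eta> \<sigma> * (\<Sum>\<gamma>\<in>G - {\<sigma>}. coupled g \<eta> \<sigma> \<gamma>))
      = (\<Sum>\<eta>\<in>UNIV. \<Sum>\<sigma>\<in>G. \<Sum>\<gamma>\<in>G - {\<sigma>}. A \<eta> \<sigma> \<gamma> + B \<eta> \<sigma> \<gamma> + B (\<sigma> \<eta>) \<sigma> \<gamma>)"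
    by (intro sum.cong refl) (simp add: sum_distrib_left split)
  then show ?thesis
    by (simp add: sum.distrib A0 B0 C0)
qed

text \<open>Summation by parts: average the left-hand side with its image under the substitution of
  \<sigma>\<eta> for \<eta>. Constant h gives invariance of m; h = \<phi>'(f) gives minus the
  energy.\<close>

lemma sum_generator: "(\<Sum>\<eta>\<in>UNIV. m \<eta> * (h \<eta> * generator G c f \<eta>))
    = - 1 / 2 * (\<Sum>\<eta>\<in>UNIV. \<Sum>\<sigma>\<in>G. m \<eta> * c \<eta> \<sigma> * ((h (\<sigma> \<eta>) - h \<eta>) * (f (\<sigma> \<eta>) - f \<eta>)))"
proof -
  define A where "A \<eta> \<sigma> = m \<eta> * c \<eta> \<sigma> * (h \<eta> * (f (\<sigma> \<eta>) - f \<eta>))" for \<eta> \<sigma>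
  have "(\<Sum>\<eta>\<in>UNIV. m \<eta> * (h \<eta> * generator G c f \<eta>)) = (\<Sum>\<eta>\<in>UNIV. \<Sum>\<sigma>\<in>G. A \<eta> \<sigma>)"
    by (simp add: generator_def nabla_def A_def sum_distrib_left mult_ac)
  moreover have "(\<Sum>\<eta>\<in>UNIV. \<Sum>\<sigma>\<in>G. A \<eta> \<sigma>) = (\<Sum>\<eta>\<in>UNIV. \<Sum>\<sigma>\<in>G. A (\<sigma> \<eta>) \<sigma>)"
    by (subst (1 2) sum.swap) (intro sum.cong refl sum_UNIV_move[symmetric])
  moreover have "(\<Sum>\<eta>\<in>UNIV. \<Sum>\<sigma>\<in>G. m \<eta> * c \<eta> \<sigma> * ((h (\<sigma> \<eta>) - h \<eta>) * (f (\<sigma> \<eta>) - f \<eta>)))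
      = (\<Sum>\<eta>\<in>UNIV. \<Sum>\<sigma>\<in>G. - A \<eta> \<sigma> - A (\<sigma> \<eta>) \<sigma>)"
    by (intro sum.cong refl) (simp add: A_def reversible involution algebra_simps)
  ultimately show ?thesis
    by (simp add: sum_subtractf sum_negf)
qed

end

section \<open>Energy dissipation and the convex Sobolev inequality\<close>

locale glauber_entropy = commuting_glauber G c m + supported_entropy \<phi>
  for G :: "('a::finite \<Rightarrow> 'a) set" and c :: "'a \<Rightarrow> ('a \<Rightarrow> 'a) \<Rightarrow> real"
    and m :: "'a \<Rightarrow> real" and \<phi> :: "real \<Rightarrow> real"
begin

lemma energy_term_nonneg:
  "(\<And>\<eta>. f \<eta> > 0) \<Longrightarrow> m \<eta> * c \<eta> \<sigma> * Phi \<phi> (f \<eta>) (f (\<sigma> \<eta>)) \<ge> 0"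
  by (intro mult_nonneg_nonneg[OF weight_nonneg] Phi_nonneg)

lemma energy_nonneg: "(\<And>\<eta>. f \<eta> > 0) \<Longrightarrow> energy \<phi> f \<ge> 0"
  unfolding energy_def by (simp add: sum_nonneg energy_term_nonneg)

text \<open>The supporting plane at (f(\<eta>), f(\<sigma>\<eta>)) is compared with
  \<open>Phi\<close> at the landing pair of each non-merging jump. The merging terms stay in exact
  form, since their treatment depends on the entropy.\<close>

lemma coupling_bound:
  assumes f: "\<And>\<eta>. f \<eta> > 0" and \<sigma>: "\<sigma> \<in> G"
  defines "P \<equiv> \<lambda>\<eta>. dPhi \<phi> (f \<eta>) (f (\<sigma> \<eta>))"
    and "Q \<equiv> \<lambda>\<eta>. dPhi \<phi> (f (\<sigma> \<eta>)) (f \<eta>)"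
  shows "P \<eta> * generator G c f \<eta> + Q \<eta> * generator G c f (\<sigma> \<eta>)
    \<le> (\<Sum>\<gamma>\<in>G - {\<sigma>}. coupled (\<lambda>x y. Phi \<phi> (f x) (f y)) \<eta> \<sigma> \<gamma>)
      + kappa G c \<eta> \<sigma> * (Q \<eta> * (f \<eta> - f (\<sigma> \<eta>)))
      + kappa G c (\<sigma> \<eta>) \<sigma> * (P \<eta> * (f (\<sigma> \<eta>) - f \<eta>))"
proof -
  define a b where "a = f \<eta>" and "b = f (\<sigma> \<eta>)"
  define S where "S \<gamma> = surplus \<eta> \<sigma> \<gamma>" for \<gamma>
  define T where "T \<gamma> = max (c (\<sigma> \<eta>) \<gamma> - c \<eta> \<gamma>) 0" for \<gamma>
  have pos: "a > 0" "b > 0" by (simp_all add: a_def b_def f)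
  \<comment> \<open>The rate of \<sigma> at \<eta> is split into the merging rate and the shares
    \<open>T \<gamma>\<close> paired with one-sided moves of the other copy.\<close>
  have gen1: "generator G c f \<eta> = (kappa G c (\<sigma> \<eta>) \<sigma> + (\<Sum>\<gamma>\<in>G - {\<sigma>}. T \<gamma>)) * (b - a)
      + (\<Sum>\<gamma>\<in>G - {\<sigma>}. c \<eta> \<gamma> * (f (\<gamma> \<eta>) - a))"
    unfolding generator_def nabla_def sum.remove[OF finite_G \<sigma>]
    by (simp add: kappa_move_eq \<sigma> T_def a_def b_def)
  have gen2: "generator G c f (\<sigma> \<eta>) = (kappa G c \<eta> \<sigma> + (\<Sum>\<gamma>\<in>G - {\<sigma>}. S \<gamma>)) * (a - b)
      + (\<Sum>\<gamma>\<in>G - {\<sigma>}. c (\<sigma> \<eta>) \<gamma> * (f (\<gamma> (\<sigma> \<eta>)) - b))"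
    unfolding generator_def nabla_def sum.remove[OF finite_G \<sigma>]
    by (simp add: kappa_eq \<sigma> S_def a_def b_def involution)
  have pair: "P \<eta> * (T \<gamma> * (b - a) + c \<eta> \<gamma> * (f (\<gamma> \<eta>) - a))
      + Q \<eta> * (S \<gamma> * (a - b) + c (\<sigma> \<eta>) \<gamma> * (f (\<gamma> (\<sigma> \<eta>)) - b))
      \<le> coupled (\<lambda>x y. Phi \<phi> (f x) (f y)) \<eta> \<sigma> \<gamma>" for \<gamma>
  proof -
    define J where "J = joint \<eta> \<sigma> \<gamma>"
    define x y where "x = f (\<gamma> \<eta>)" and "y = f (\<gamma> (\<sigma> \<eta>))"
    have xy: "x > 0" "y > 0" by (simp_all add: x_def y_def f)
    have c1: "c \<eta> \<gamma> = J + S \<gamma>" and c2: "c (\<sigma> \<eta>) \<gamma> = J + T \<gamma>"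
      by (auto simp: J_def S_def T_def)
    have nn: "J \<ge> 0" "S \<gamma> \<ge> 0" "T \<gamma> \<ge> 0"
      by (auto simp: J_def S_def T_def less_imp_le[OF c_pos])
    have "J * (P \<eta> * (x - a) + Q \<eta> * (y - b)) \<le> J * (Phi \<phi> x y - Phi \<phi> a b)"
      using Phi_support[OF pos xy] nn by (intro mult_left_mono) (auto simp: P_def Q_def a_def b_def)
    moreover have "S \<gamma> * (P \<eta> * (x - a) + Q \<eta> * (a - b)) \<le> S \<gamma> * (Phi \<phi> x a - Phi \<phi> a b)"
      using Phi_support[OF pos xy(1) pos(1)] nn
      by (intro mult_left_mono) (auto simp: P_def Q_def a_def b_def)
    moreover have "T \<gamma> * (P \<eta> * (b - a) + Q \<eta> * (y - b)) \<le> T \<gamma> * (Phi \<phi> b y - Phi \<phi> a b)"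
      using Phi_support[OF pos pos(2) xy(2)] nn
      by (intro mult_left_mono) (auto simp: P_def Q_def a_def b_def)
    moreover have "coupled (\<lambda>x y. Phi \<phi> (f x) (f y)) \<eta> \<sigma> \<gamma> = J * (Phi \<phi> x y - Phi \<phi> a b)
        + S \<gamma> * (Phi \<phi> x a - Phi \<phi> a b) + T \<gamma> * (Phi \<phi> b y - Phi \<phi> a b)"
      by (simp add: coupled_def J_def S_def T_def x_def y_def a_def b_def)
    ultimately show ?thesis
      unfolding c1 c2 x_def[symmetric] y_def[symmetric] by (simp add: algebra_simps)
  qed
  have "P \<eta> * generator G c f \<eta> + Q \<eta> * generator G c f (\<sigma> \<eta>)
      = (\<Sum>\<gamma>\<in>G - {\<sigma>}. P \<eta> * (T \<gamma> * (b - a) + c \<eta> \<gamma> * (f (\<gamma> \<eta>) - a))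
        + Q \<eta> * (S \<gamma> * (a - b) + c (\<sigma> \<eta>) \<gamma> * (f (\<gamma> (\<sigma> \<eta>)) - b)))
        + kappa G c \<eta> \<sigma> * (Q \<eta> * (a - b)) + kappa G c (\<sigma> \<eta>) \<sigma> * (P \<eta> * (b - a))"
    unfolding gen1 gen2
    by (simp add: sum.distrib sum_distrib_left[symmetric] sum_distrib_right[symmetric])
      (simp add: algebra_simps)
  then show ?thesis
    using sum_mono[of "G - {\<sigma>}", OF pair] by (simp add: a_def b_def)
qed

text \<open>On the left are the merging terms of \<open>coupling_bound\<close> with f(\<eta>) = a
  and f(\<sigma>\<eta>) = b. Each of the three constants comes from a pointwise estimate of this
  kind.\<close>

definition contraction_rate :: "real \<Rightarrow> bool" where
  "contraction_rate K \<longleftrightarrow> (\<forall>\<eta>. \<forall>\<sigma>\<in>G. \<forall>a>0. \<forall>b>0.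
     kappa G c \<eta> \<sigma> * (dPhi \<phi> b a * (a - b)) + kappa G c (\<sigma> \<eta>) \<sigma> * (dPhi \<phi> a b * (b - a))
       \<le> - K * Phi \<phi> a b)"

definition energy_slope :: "('a \<Rightarrow> real) \<Rightarrow> ('a \<Rightarrow> real) \<Rightarrow> real" where
  "energy_slope f g = 1 / 2 * (\<Sum>\<eta>\<in>UNIV. \<Sum>\<sigma>\<in>G. m \<eta> * c \<eta> \<sigma> *
     (dPhi \<phi> (f \<eta>) (f (\<sigma> \<eta>)) * g \<eta> + dPhi \<phi> (f (\<sigma> \<eta>)) (f \<eta>) * g (\<sigma> \<eta>)))"

text \<open>\<open>coupling_bound\<close> is summed over all edges; \<open>sum_coupled\<close>
  removes the non-merging jumps and \<open>contraction_rate\<close> bounds the merging ones.\<close>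

lemma energy_dissipation:
  assumes f: "\<And>\<eta>. f \<eta> > 0" and K: "contraction_rate K"
  shows "energy_slope f (generator G c f) \<le> - K * energy \<phi> f"
proof -
  let ?g = "\<lambda>x y. Phi \<phi> (f x) (f y)"
  have "(\<Sum>\<eta>\<in>UNIV. \<Sum>\<sigma>\<in>G. m \<eta> * c \<eta> \<sigma> *
     (dPhi \<phi> (f \<eta>) (f (\<sigma> \<eta>)) * generator G c f \<eta> + dPhi \<phi> (f (\<sigma> \<eta>)) (f \<eta>) * generator G c f (\<sigma> \<eta>)))
    \<le> (\<Sum>\<eta>\<in>UNIV. \<Sum>\<sigma>\<in>G. m \<eta> * c \<eta> \<sigma> *
        ((\<Sum>\<gamma>\<in>G - {\<sigma>}. coupled ?g \<eta> \<sigma> \<gamma>) + - K * ?g \<eta> (\<sigma> \<eta>)))"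
  proof (intro sum_mono mult_left_mono)
    fix \<eta> \<sigma> assume \<sigma>: "\<sigma> \<in> G"
    show "dPhi \<phi> (f \<eta>) (f (\<sigma> \<eta>)) * generator G c f \<eta>
        + dPhi \<phi> (f (\<sigma> \<eta>)) (f \<eta>) * generator G c f (\<sigma> \<eta>)
      \<le> (\<Sum>\<gamma>\<in>G - {\<sigma>}. coupled ?g \<eta> \<sigma> \<gamma>) + - K * ?g \<eta> (\<sigma> \<eta>)"
    proof -
      have "kappa G c \<eta> \<sigma> * (dPhi \<phi> (f (\<sigma> \<eta>)) (f \<eta>) * (f \<eta> - f (\<sigma> \<eta>)))
          + kappa G c (\<sigma> \<eta>) \<sigma> * (dPhi \<phi> (f \<eta>) (f (\<sigma> \<eta>)) * (f (\<sigma> \<eta>) - f \<eta>))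
          \<le> - K * ?g \<eta> (\<sigma> \<eta>)"
        using K \<sigma> f by (simp add: contraction_rate_def)
      with coupling_bound[where f = f and \<eta> = \<eta>, OF f \<sigma>] show ?thesis by linarith
    qed
  qed (rule weight_nonneg)
  also have "\<dots> = - K * (\<Sum>\<eta>\<in>UNIV. \<Sum>\<sigma>\<in>G. m \<eta> * c \<eta> \<sigma> * ?g \<eta> (\<sigma> \<eta>))"
    using sum_coupled[of ?g, OF Phi_sym]
    by (simp only: distrib_left sum.distrib) (simp add: sum_distrib_left mult_ac)
  finally show ?thesis
    by (simp add: energy_slope_def energy_def)
qed

lemma DERIV_energy:
  assumes f: "\<And>\<eta>. f \<eta> > 0"
  shows "((\<lambda>t. energy \<phi> (\<lambda>\<eta>. f \<eta> + t * g \<eta>)) has_real_derivative energy_slope f g) (at 0)"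
  unfolding energy_def energy_slope_def
  by (intro DERIV_cmult DERIV_sum DERIV_Phi_line f)

lemma DERIV_entropy:
  assumes f: "\<And>\<eta>. f \<eta> > 0"
  shows "((\<lambda>t. phi_entropy \<phi> (\<lambda>\<eta>. f \<eta> + t * generator G c f \<eta>) m) has_real_derivative
    - energy \<phi> f) (at 0)"
proof -
  let ?g = "generator G c f"
  \<comment> \<open>The mean is conserved, so only the first term of the entropy varies.\<close>
  have "(\<Sum>\<eta>\<in>UNIV. (f \<eta> + t * ?g \<eta>) * m \<eta>) = (\<Sum>\<eta>\<in>UNIV. f \<eta> * m \<eta>)" for t
    using sum_generator[of "\<lambda>_. t" f] by (simp add: algebra_simps sum.distrib)
  moreover have "((\<lambda>t. (\<Sum>\<eta>\<in>UNIV. \<phi> (f \<eta> + t * ?g \<eta>) * m \<eta>)) has_real_derivative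
      (\<Sum>\<eta>\<in>UNIV. deriv \<phi> (f \<eta>) * ?g \<eta> * m \<eta>)) (at 0)"
    by (intro DERIV_sum DERIV_cmult_right DERIV_phi_line f)
  moreover have "(\<Sum>\<eta>\<in>UNIV. deriv \<phi> (f \<eta>) * ?g \<eta> * m \<eta>) = - energy \<phi> f"
    using sum_generator[of "\<lambda>\<eta>. deriv \<phi> (f \<eta>)" f] by (simp add: energy_def Phi_def mult_ac)
  ultimately show ?thesis
    unfolding phi_entropy_def using DERIV_diff[OF _ DERIV_const] by fastforce
qed

text \<open>As \<phi> may have affine pieces, f need not be constant. Instead \<phi>'(f) is constant
  along edges, hence everywhere by irreducibility, and equality holds in Jensen's
  inequality.\<close>

lemma zero_energy_imp_zero_entropy:
  assumes f: "\<And>\<eta>. f \<eta> > 0" and E: "energy \<phi> f = 0"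
    and irr: "irreducible_generator (generator G c)"
  shows "phi_entropy \<phi> f m = 0"
proof -
  have "m \<eta> * c \<eta> \<sigma> * Phi \<phi> (f \<eta>) (f (\<sigma> \<eta>)) = 0" if "\<sigma> \<in> G" for \<eta> \<sigma>
  proof -
    note nn = energy_term_nonneg[where f = f, OF f]
    have "(\<Sum>\<sigma>\<in>G. m \<eta> * c \<eta> \<sigma> * Phi \<phi> (f \<eta>) (f (\<sigma> \<eta>))) = 0" for \<eta>
      using E unfolding energy_def by (simp add: sum_nonneg_eq_0_iff sum_nonneg nn)
    moreover have "(\<Sum>\<sigma>\<in>G. m \<eta> * c \<eta> \<sigma> * Phi \<phi> (f \<eta>) (f (\<sigma> \<eta>))) = 0
        \<longleftrightarrow> (\<forall>\<sigma>\<in>G. m \<eta> * c \<eta> \<sigma> * Phi \<phi> (f \<eta>) (f (\<sigma> \<eta>)) = 0)"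
      by (rule sum_nonneg_eq_0_iff[OF finite_G nn])
    ultimately show ?thesis
      using that by blast
  qed
  then have edge: "deriv \<phi> (f (\<sigma> \<eta>)) = deriv \<phi> (f \<eta>)" if "\<sigma> \<in> G" for \<eta> \<sigma>
    using that m_pos[of \<eta>] c_pos[of \<eta> \<sigma>] by (force simp: Phi_def)
  have eq: "deriv \<phi> (f y) = deriv \<phi> (f x)" for x y
  proof -
    have "(x, y) \<in> {(x, y). x \<noteq> y \<and> generator G c (indicator {y}) x > 0}\<^sup>*"
      using irr by (simp add: irreducible_generator_def)
    then show ?thesis
    proof (induction rule: rtrancl_induct)
      case (step y z)
      then have "y \<noteq> z" "generator G c (indicator {z}) y \<noteq> 0" by auto
      then obtain \<sigma> where "\<sigma> \<in> G" "c y \<sigma> * nabla \<sigma> (indicator {z}) y \<noteq> 0"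
        unfolding generator_def by (meson sum.neutral)
      with \<open>y \<noteq> z\<close> have "\<sigma> \<in> G" "\<sigma> y = z"
        by (auto simp: nabla_def indicator_def split: if_splits)
      then show ?case
        using edge[of \<sigma> y] step.IH by simp
    qed simp
  qed
  define M where "M = (\<Sum>\<eta>\<in>UNIV. f \<eta> * m \<eta>)"
  define k where "k = deriv \<phi> (f undefined)"
  have M: "M > 0"
    unfolding M_def by (intro sum_pos mult_pos_pos f m_pos) auto
  \<comment> \<open>All tangents at values of f share the slope k. Averaging them at the mean M
    reverses Jensen's inequality.\<close>
  have tangent: "\<phi> (f \<eta>) + k * (M - f \<eta>) \<le> \<phi> M" for \<eta>
    using support[OF f M, of \<eta>] by (simp only: k_def eq[of undefined \<eta>])
  have "(\<Sum>\<eta>\<in>UNIV. (\<phi> (f \<eta>) + k * (M - f \<eta>)) * m \<eta>) \<le> (\<Sum>\<eta>\<in>UNIV. \<phi> M * m \<eta>)"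
    by (intro sum_mono mult_right_mono tangent less_imp_le[OF m_pos])
  moreover have "(\<Sum>\<eta>\<in>UNIV. (\<phi> (f \<eta>) + k * (M - f \<eta>)) * m \<eta>)
      = (\<Sum>\<eta>\<in>UNIV. \<phi> (f \<eta>) * m \<eta>) + k * (M * (\<Sum>\<eta>\<in>UNIV. m \<eta>) - (\<Sum>\<eta>\<in>UNIV. f \<eta> * m \<eta>))"
    by (simp add: algebra_simps sum.distrib sum_subtractf sum_distrib_left)
  moreover have "(\<Sum>\<eta>\<in>UNIV. \<phi> M * m \<eta>) = \<phi> M"
    by (simp add: sum_distrib_left[symmetric] m_sum)
  ultimately have "phi_entropy \<phi> f m \<le> 0"
    by (simp add: phi_entropy_def M_def m_sum)
  \<comment> \<open>Jensen's inequality itself, from the tangent at M.\<close>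
  moreover have "(\<Sum>\<eta>\<in>UNIV. (\<phi> M + deriv \<phi> M * (f \<eta> - M)) * m \<eta>) \<le> (\<Sum>\<eta>\<in>UNIV. \<phi> (f \<eta>) * m \<eta>)"
    using support[OF M f] m_pos by (intro sum_mono mult_right_mono) (auto simp: less_imp_le)
  moreover have "(\<Sum>\<eta>\<in>UNIV. (\<phi> M + deriv \<phi> M * (f \<eta> - M)) * m \<eta>)
      = \<phi> M * (\<Sum>\<eta>\<in>UNIV. m \<eta>) + deriv \<phi> M * ((\<Sum>\<eta>\<in>UNIV. f \<eta> * m \<eta>) - M * (\<Sum>\<eta>\<in>UNIV. m \<eta>))"
    by (simp add: algebra_simps sum.distrib sum_subtractf sum_distrib_left)
  ultimately show ?thesis
    by (simp add: phi_entropy_def M_def m_sum)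
qed

text \<open>For small t the Euler step is a convex combination of f(\<eta>) and the values at its
  neighbours.\<close>

lemma euler_step_in_interval:
  assumes f: "\<And>\<eta>. f \<eta> \<in> {l..u}" and t: "t \<ge> 0" "t * (\<Sum>\<sigma>\<in>G. c \<eta> \<sigma>) \<le> 1"
  shows "f \<eta> + t * generator G c f \<eta> \<in> {l..u}"
proof -
  have eq: "f \<eta> + t * generator G c f \<eta>
      = (1 - t * (\<Sum>\<sigma>\<in>G. c \<eta> \<sigma>)) * f \<eta> + t * (\<Sum>\<sigma>\<in>G. c \<eta> \<sigma> * f (\<sigma> \<eta>))"
    by (simp add: generator_def nabla_def algebra_simps sum_subtractf sum_distrib_left)
  have "(\<Sum>\<sigma>\<in>G. c \<eta> \<sigma>) * l \<le> (\<Sum>\<sigma>\<in>G. c \<eta> \<sigma> * f (\<sigma> \<eta>))"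
    and "(\<Sum>\<sigma>\<in>G. c \<eta> \<sigma> * f (\<sigma> \<eta>)) \<le> (\<Sum>\<sigma>\<in>G. c \<eta> \<sigma>) * u"
    using f c_pos by (auto simp: sum_distrib_right less_imp_le intro!: sum_mono)
  then have "t * ((\<Sum>\<sigma>\<in>G. c \<eta> \<sigma>) * l) \<le> t * (\<Sum>\<sigma>\<in>G. c \<eta> \<sigma> * f (\<sigma> \<eta>))"
    and "t * (\<Sum>\<sigma>\<in>G. c \<eta> \<sigma> * f (\<sigma> \<eta>)) \<le> t * ((\<Sum>\<sigma>\<in>G. c \<eta> \<sigma>) * u)"
    using t by (auto intro: mult_left_mono)
  moreover have "(1 - t * (\<Sum>\<sigma>\<in>G. c \<eta> \<sigma>)) * l \<le> (1 - t * (\<Sum>\<sigma>\<in>G. c \<eta> \<sigma>)) * f \<eta>"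
    and "(1 - t * (\<Sum>\<sigma>\<in>G. c \<eta> \<sigma>)) * f \<eta> \<le> (1 - t * (\<Sum>\<sigma>\<in>G. c \<eta> \<sigma>)) * u"
    using f[of \<eta>] t by (auto intro: mult_left_mono)
  ultimately show ?thesis
    unfolding eq by (auto simp: algebra_simps)
qed

lemma phi_entropy_le_energy_strict:
  assumes f: "\<And>\<eta>. f \<eta> > 0" and K: "contraction_rate K" and k: "k < K"
    and irr: "irreducible_generator (generator G c)"
  shows "k * phi_entropy \<phi> f m \<le> energy \<phi> f"
proof -
  define J where "J h = energy \<phi> h - k * phi_entropy \<phi> h m" for h
  \<comment> \<open>Since l > 0, the box of functions with values between l and u stays where \<phi>
    and \<phi>' are continuous.\<close>
  define l u where "l = Min (range f)" and "u = Max (range f)"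
  have l: "l > 0" by (simp add: l_def f)
  have fin: "f \<eta> \<in> {l..u}" for \<eta> by (simp add: l_def u_def)
  \<comment> \<open>Functions are encoded as vectors, which makes the box a compact
    \<open>cbox\<close>.\<close>
  define B :: "(real ^ 'a) set" where "B = {v. \<forall>\<eta>. v $ \<eta> \<in> {l..u}}"
  have B: "B = cbox (\<chi> _. l) (\<chi> _. u)"
    by (auto simp: B_def mem_box_cart)
  have contphi: "continuous_on {l..u} \<phi>" and contd: "continuous_on {l..u} (deriv \<phi>)"
    using l by (auto intro!: DERIV_continuous_on DERIV_subset[OF DERIV_phi]
        DERIV_subset[OF DERIV_deriv_phi])
  have coord: "continuous_on B (\<lambda>v. v $ \<eta>)" for \<eta>
    by (intro continuous_intros)
  have mean: "(\<Sum>\<eta>\<in>UNIV. v $ \<eta> * m \<eta>) \<in> {l..u}" if "v \<in> B" for v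
  proof -
    have "(\<Sum>\<eta>\<in>UNIV. l * m \<eta>) \<le> (\<Sum>\<eta>\<in>UNIV. v $ \<eta> * m \<eta>)"
      and "(\<Sum>\<eta>\<in>UNIV. v $ \<eta> * m \<eta>) \<le> (\<Sum>\<eta>\<in>UNIV. u * m \<eta>)"
      using that by (auto simp: B_def less_imp_le[OF m_pos] intro!: sum_mono mult_right_mono)
    then show ?thesis
      by (simp add: sum_distrib_left[symmetric] m_sum)
  qed
  have "continuous_on B (\<lambda>v. J (($) v))"
    unfolding J_def energy_def phi_entropy_def Phi_def
    by (intro continuous_intros continuous_on_compose2[OF contphi] continuous_on_compose2[OF contd]
        coord) (use mean in \<open>auto simp: B_def\<close>)
  moreover have "compact B" "B \<noteq> {}"
    using fin[unfolded atLeastAtMost_iff] by (auto simp: B interval_ne_empty_cart intro: order_trans)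
  ultimately obtain v where v: "v \<in> B" "\<And>w. w \<in> B \<Longrightarrow> J (($) v) \<le> J (($) w)"
    using continuous_attains_inf by metis
  define h where "h = ($) v"
  have h: "h \<eta> \<in> {l..u}" for \<eta> using v by (simp add: h_def B_def)
  have hpos: "h \<eta> > 0" for \<eta> using h[of \<eta>] l by simp
  have min: "J h \<le> J g" if "\<And>\<eta>. g \<eta> \<in> {l..u}" for g
  proof -
    have "(\<chi> \<eta>. g \<eta>) \<in> B" using that by (simp add: B_def)
    from v(2)[OF this] show ?thesis by (simp add: h_def vec_lambda_inverse)
  qed
  define L where "L = generator G c h"
  \<comment> \<open>The entropy has derivative minus the energy, so subtracting k times it
    contributes \<open>+ k * energy \<phi> h\<close>.\<close>
  define D where "D = energy_slope h L + k * energy \<phi> h"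
  have DJ: "((\<lambda>t. J (\<lambda>\<eta>. h \<eta> + t * L \<eta>)) has_real_derivative D) (at 0)"
    unfolding J_def D_def
    by (rule derivative_eq_intros DERIV_energy DERIV_entropy[folded L_def] hpos refl | simp add: L_def)+
  have "D \<ge> 0"
  proof (rule ccontr)
    assume "\<not> D \<ge> 0"
    then obtain d where d: "d > 0" "\<And>t. t > 0 \<Longrightarrow> t < d \<Longrightarrow> J (\<lambda>\<eta>. h \<eta> + t * L \<eta>) < J h"
      using has_real_derivative_neg_dec_right[OF DJ[THEN DERIV_subset], of UNIV] by auto
    \<comment> \<open>A positive bound for the total jump rate at every state; the 1 keeps it
      positive even for empty G.\<close>
    define s where "s = 1 + (\<Sum>\<eta>\<in>UNIV. \<Sum>\<sigma>\<in>G. c \<eta> \<sigma>)"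
    have cs: "(\<Sum>\<sigma>\<in>G. c \<eta> \<sigma>) \<le> s" for \<eta>
      unfolding s_def
      using member_le_sum[of \<eta> UNIV "\<lambda>\<eta>. \<Sum>\<sigma>\<in>G. c \<eta> \<sigma>"] by (simp add: sum_nonneg less_imp_le[OF c_pos])
    have s: "s > 0"
      unfolding s_def by (intro add_pos_nonneg sum_nonneg) (auto simp: less_imp_le[OF c_pos])
    define t where "t = min (d / 2) (1 / s)"
    have t: "t > 0" "t < d" "t * s \<le> 1"
      using d(1) s by (auto simp: t_def min_def field_simps)
    have "t * (\<Sum>\<sigma>\<in>G. c \<eta> \<sigma>) \<le> 1" for \<eta>
      using mult_left_mono[OF cs[of \<eta>], of t] t by linarith
    then have "J h \<le> J (\<lambda>\<eta>. h \<eta> + t * L \<eta>)"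
      unfolding L_def using t by (intro min euler_step_in_interval h) auto
    with d(2)[OF t(1,2)] show False by simp
  qed
  with energy_dissipation[where f = h, OF hpos K] have "(K - k) * energy \<phi> h \<le> 0"
    by (simp add: D_def L_def algebra_simps)
  with k energy_nonneg[of h] hpos have E: "energy \<phi> h = 0"
    by (smt (verit) mult_pos_pos)
  have "J h \<ge> 0"
    using zero_energy_imp_zero_entropy[OF hpos E irr] by (simp add: J_def E)
  also have "J h \<le> J f" by (rule min) (rule fin)
  finally show ?thesis by (simp add: J_def)
qed

text \<open>The strict bound is applied with k = K - 1/(n+1), and n tends to infinity.\<close>

lemma convex_Sobolev_of_rate:
  assumes "contraction_rate K" and "irreducible_generator (generator G c)"
  shows "convex_Sobolev G c m \<phi> K"
  unfolding convex_Sobolev_iff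
proof (intro allI impI)
  fix f :: "'a \<Rightarrow> real" assume f: "\<forall>\<eta>. f \<eta> > 0"
  have "(\<lambda>n. (K - inverse (real (Suc n))) * phi_entropy \<phi> f m) \<longlonglongrightarrow> (K - 0) * phi_entropy \<phi> f m"
    by (intro tendsto_intros LIMSEQ_inverse_real_of_nat)
  then have "(K - 0) * phi_entropy \<phi> f m \<le> energy \<phi> f"
    by (rule LIMSEQ_le_const2)
      (use f assms in \<open>auto intro!: exI[of _ 0] phi_entropy_le_energy_strict\<close>)
  then show "K * phi_entropy \<phi> f m \<le> energy \<phi> f" by simp
qed

lemma kappa_inf_le: "\<sigma> \<in> G \<Longrightarrow> kappa_inf G c \<le> kappa G c \<eta> \<sigma> + kappa G c (\<sigma> \<eta>) \<sigma>"
  unfolding kappa_inf_def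
  using cINF_lower[of "\<lambda>(\<eta>, \<sigma>). kappa G c \<eta> \<sigma> + kappa G c (\<sigma> \<eta>) \<sigma>" "UNIV \<times> G" "(\<eta>, \<sigma>)"]
  by (simp add: finite_G)

lemma kappa_bar_le: "\<sigma> \<in> G \<Longrightarrow> kappa_bar G c \<le> kappa G c \<eta> \<sigma>"
  unfolding kappa_bar_def
  using cINF_lower[of "\<lambda>(\<eta>, \<sigma>). kappa G c \<eta> \<sigma>" "UNIV \<times> G" "(\<eta>, \<sigma>)"]
  by (simp add: finite_G)

text \<open>Used with \<theta> = 1 for admissible entropies and \<theta> = \<alpha> for the power
  entropies.\<close>

lemma contraction_rate_mult:
  assumes \<theta>: "\<theta> \<ge> 0" and kappa: "\<And>\<eta> \<sigma>. \<sigma> \<in> G \<Longrightarrow> kappa G c \<eta> \<sigma> \<ge> 0"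
    and dPhi: "\<And>a b. a > 0 \<Longrightarrow> b > 0 \<Longrightarrow> dPhi \<phi> b a * (a - b) \<le> - \<theta> * Phi \<phi> a b"
  shows "contraction_rate (\<theta> * kappa_inf G c)"
  unfolding contraction_rate_def
proof (intro allI ballI impI)
  fix \<eta> \<sigma> and a b :: real assume \<sigma>: "\<sigma> \<in> G" and pos: "a > 0" "b > 0"
  have "kappa G c \<eta> \<sigma> * (dPhi \<phi> b a * (a - b)) \<le> kappa G c \<eta> \<sigma> * (- \<theta> * Phi \<phi> a b)"
    by (intro mult_left_mono dPhi pos kappa \<sigma>)
  moreover have "kappa G c (\<sigma> \<eta>) \<sigma> * (dPhi \<phi> a b * (b - a)) \<le> kappa G c (\<sigma> \<eta>) \<sigma> * (- \<theta> * Phi \<phi> a b)"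
    unfolding Phi_sym[of _ a b] by (intro mult_left_mono dPhi pos kappa \<sigma>)
  moreover have "kappa_inf G c * (\<theta> * Phi \<phi> a b)
      \<le> (kappa G c \<eta> \<sigma> + kappa G c (\<sigma> \<eta>) \<sigma>) * (\<theta> * Phi \<phi> a b)"
    by (intro mult_right_mono kappa_inf_le \<sigma> mult_nonneg_nonneg \<theta> Phi_nonneg pos)
  ultimately show "kappa G c \<eta> \<sigma> * (dPhi \<phi> b a * (a - b))
      + kappa G c (\<sigma> \<eta>) \<sigma> * (dPhi \<phi> a b * (b - a)) \<le> - (\<theta> * kappa_inf G c) * Phi \<phi> a b"
    by (simp add: algebra_simps)
qed

lemma contraction_rate_kappa_inf:
  assumes "\<And>\<eta> \<sigma>. \<sigma> \<in> G \<Longrightarrow> kappa G c \<eta> \<sigma> \<ge> 0"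
  shows "contraction_rate (kappa_inf G c)"
proof -
  \<comment> \<open>The supporting plane at (a, b) is evaluated at the diagonal point (a, a), where
    \<open>Phi\<close> vanishes.\<close>
  have "dPhi \<phi> b a * (a - b) \<le> - 1 * Phi \<phi> a b" if "a > 0" "b > 0" for a b
    using Phi_support[OF that that(1,1)] by simp
  from contraction_rate_mult[OF _ assms this] show ?thesis by simp
qed

text \<open>Here r is the gap between the supporting plane and \<open>Phi\<close> at the diagonal.
  Both gaps carry weights of at least \<open>kappa_bar\<close>, and together they are worth 2
  \<open>Phi\<close>, whence the extra \<open>2 * kappa_bar\<close>.\<close>

lemma contraction_rate_kappa_bar:
  assumes kappa: "\<And>\<eta> \<sigma>. \<sigma> \<in> G \<Longrightarrow> kappa G c \<eta> \<sigma> \<ge> 0"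
    and dPhi: "\<And>a b. a > 0 \<Longrightarrow> b > 0 \<Longrightarrow> dPhi \<phi> b a * (a - b) = - Phi \<phi> a b - r a b"
    and r: "\<And>a b. a > 0 \<Longrightarrow> b > 0 \<Longrightarrow> r a b \<ge> 0"
    and r_sum: "\<And>a b. a > 0 \<Longrightarrow> b > 0 \<Longrightarrow> 2 * Phi \<phi> a b \<le> r a b + r b a"
  shows "contraction_rate (kappa_inf G c + 2 * kappa_bar G c)"
  unfolding contraction_rate_def
proof (intro allI ballI impI)
  fix \<eta> \<sigma> and a b :: real assume \<sigma>: "\<sigma> \<in> G" and pos: "a > 0" "b > 0"
  have bar: "kappa_bar G c \<ge> 0"
    unfolding kappa_bar_def by (rule cINF_greatest) (use \<sigma> kappa in auto)
  have "kappa_inf G c * Phi \<phi> a b \<le> (kappa G c \<eta> \<sigma> + kappa G c (\<sigma> \<eta>) \<sigma>) * Phi \<phi> a b"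
    by (intro mult_right_mono kappa_inf_le \<sigma> Phi_nonneg pos)
  moreover have "kappa_bar G c * r a b \<le> kappa G c \<eta> \<sigma> * r a b"
    by (intro mult_right_mono kappa_bar_le \<sigma> r pos)
  moreover have "kappa_bar G c * r b a \<le> kappa G c (\<sigma> \<eta>) \<sigma> * r b a"
    by (intro mult_right_mono kappa_bar_le \<sigma> r pos)
  moreover have "kappa_bar G c * (2 * Phi \<phi> a b) \<le> kappa_bar G c * (r a b + r b a)"
    by (intro mult_left_mono bar r_sum pos)
  ultimately show "kappa G c \<eta> \<sigma> * (dPhi \<phi> b a * (a - b))
      + kappa G c (\<sigma> \<eta>) \<sigma> * (dPhi \<phi> a b * (b - a))
      \<le> - (kappa_inf G c + 2 * kappa_bar G c) * Phi \<phi> a b"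
    unfolding dPhi[OF pos] dPhi[OF pos(2,1)] Phi_sym[of _ b a] by (simp add: algebra_simps)
qed

end

section \<open>Supporting planes for admissible entropies\<close>

lemma supported_entropy_of_admissible:
  assumes "admissible \<phi>"
  shows "supported_entropy \<phi>"
proof -
  have diff: "\<And>x. x > 0 \<Longrightarrow> \<phi> differentiable (at x)"
      "\<And>x. x > 0 \<Longrightarrow> deriv \<phi> differentiable (at x)"
    and conv: "convex_on {0..} \<phi>" "convex_on ({0<..} \<times> {0<..}) (\<lambda>(a, b). Phi \<phi> a b)"
    using assms unfolding admissible_def by blast+
  interpret smooth_entropy \<phi>
    by standard (simp_all only: DERIV_deriv_iff_real_differentiable diff)
  show ?thesis
  proof
    have "convex_on {0<..} \<phi>"
      by (rule convex_on_subset[OF conv(1)]) auto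
    then show "\<phi> x + deriv \<phi> x * (y - x) \<le> \<phi> y" if "x > 0" "y > 0" for x y
      using that by (rule support_of_convex)
    fix a b x y :: real
    assume pos: "a > 0" "b > 0" "x > 0" "y > 0"
    let ?A = "{t. a + t * (x - a) > 0 \<and> b + t * (y - b) > 0}"
    have pt: "p + ((1 - s) * t + s * t') * k = (1 - s) * (p + t * k) + s * (p + t' * k)"
      for p k s t t' :: real by (simp add: algebra_simps)
    have "convex_on ?A (\<lambda>t. Phi \<phi> (a + t * (x - a)) (b + t * (y - b)))"
    proof (rule convex_onI)
      fix s t t' :: real
      assume "0 < s" "s < 1" "t \<in> ?A" "t' \<in> ?A"
      then show "Phi \<phi> (a + ((1 - s) *\<^sub>R t + s *\<^sub>R t') * (x - a)) (b + ((1 - s) *\<^sub>R t + s *\<^sub>R t') * (y - b))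
          \<le> (1 - s) * Phi \<phi> (a + t * (x - a)) (b + t * (y - b))
            + s * Phi \<phi> (a + t' * (x - a)) (b + t' * (y - b))"
        using convex_onD[OF conv(2), of s "(a + t * (x - a), b + t * (y - b))"
            "(a + t' * (x - a), b + t' * (y - b))"]
        by (simp add: pt)
    qed (rule convex_positive_line)
    then show "Phi \<phi> a b + dPhi \<phi> a b * (x - a) + dPhi \<phi> b a * (y - b) \<le> Phi \<phi> x y"
      by (rule Phi_support_of_convex) fact+
  qed
qed

section \<open>The logarithmic entropy\<close>

lemma DERIV_phi_log: "x > 0 \<Longrightarrow> (phi_log has_real_derivative ln x) (at x)"
  unfolding phi_log_def by (auto intro!: derivative_eq_intros)

lemmas smooth_phi_log = smooth_entropyI[OF DERIV_phi_log DERIV_ln]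

lemma Phi_phi_log: "a > 0 \<Longrightarrow> b > 0 \<Longrightarrow> Phi phi_log a b = (ln b - ln a) * (b - a)"
  by (simp add: Phi_def smooth_phi_log)

lemma dPhi_phi_log: "a > 0 \<Longrightarrow> b > 0 \<Longrightarrow> dPhi phi_log a b = ln a - ln b - (b - a) / a"
  by (simp add: dPhi_def smooth_phi_log divide_inverse mult.commute)

text \<open>Everything reduces to ln z \<le> z - 1. For \<open>Phi\<close> it is used at z = ya/(xb)
  and at the reciprocal, with factors x and y.\<close>

lemma supported_entropy_phi_log: "supported_entropy phi_log"
proof -
  interpret smooth_entropy phi_log by (rule smooth_phi_log)
  show ?thesis
  proof
    fix x y :: real assume pos: "x > 0" "y > 0"
    have "y * ln (x / y) \<le> y * (x / y - 1)"
      using pos by (intro mult_left_mono ln_le_minus_one) auto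
    then show "phi_log x + deriv phi_log x * (y - x) \<le> phi_log y"
      using pos by (simp add: smooth_phi_log phi_log_def ln_div algebra_simps)
  next
    fix a b x y :: real assume pos: "a > 0" "b > 0" "x > 0" "y > 0"
    have "x * ln (y * a / (x * b)) \<le> x * (y * a / (x * b) - 1)"
      using pos by (intro mult_left_mono ln_le_minus_one) auto
    then have 1: "x * (ln y + ln a - ln x - ln b) \<le> y * a / b - x"
      using pos by (simp add: ln_div ln_mult algebra_simps)
    have "y * ln (x * b / (y * a)) \<le> y * (x * b / (y * a) - 1)"
      using pos by (intro mult_left_mono ln_le_minus_one) auto
    then have 2: "y * (ln x + ln b - ln y - ln a) \<le> x * b / a - y"
      using pos by (simp add: ln_div ln_mult algebra_simps)
    have "Phi phi_log a b + dPhi phi_log a b * (x - a) + dPhi phi_log b a * (y - b)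
        = (ln a - ln b) * (x - y) + x + y - x * b / a - y * a / b"
      using pos by (simp add: Phi_phi_log dPhi_phi_log field_simps)
    also have "\<dots> \<le> (ln y - ln x) * (y - x)"
      using 1 2 by (simp add: algebra_simps)
    finally show "Phi phi_log a b + dPhi phi_log a b * (x - a) + dPhi phi_log b a * (y - b)
        \<le> Phi phi_log x y"
      using pos by (simp add: Phi_phi_log)
  qed
qed

text \<open>The difference of the two sides has derivative (1 - 1/t)^2. With x = exp s this is s
  \<le> sinh s.\<close>

lemma two_ln_le:
  assumes "x \<ge> (1::real)"
  shows "2 * ln x \<le> x - 1 / x"
proof -
  have "1 - 1 / 1 - 2 * ln 1 \<le> x - 1 / x - 2 * ln x"
  proof (rule DERIV_nonneg_imp_nondecreasing[OF assms])
    fix t :: real assume t: "1 \<le> t" "t \<le> x"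
    have "((\<lambda>x. x - 1 / x - 2 * ln x) has_real_derivative (1 - 1 / t)\<^sup>2) (at t)"
      using t by (auto intro!: derivative_eq_intros simp: field_simps power2_eq_square)
    then show "\<exists>y. ((\<lambda>x. x - 1 / x - 2 * ln x) has_real_derivative y) (at t) \<and> 0 \<le> y"
      by (meson zero_le_power2)
  qed
  then show ?thesis by simp
qed

text \<open>This bounds the two merging gaps of the logarithmic entropy: \<open>two_ln_le\<close> at
  b/a, times b - a. By symmetry a \<le> b may be assumed.\<close>

lemma two_ln_diff_le:
  assumes "a > 0" "b > (0::real)"
  shows "2 * ((ln b - ln a) * (b - a)) \<le> (a - b)\<^sup>2 / b + (b - a)\<^sup>2 / a"
proof -
  have *: "2 * ((ln b - ln a) * (b - a)) \<le> (a - b)\<^sup>2 / b + (b - a)\<^sup>2 / a"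
    if "0 < a" "a \<le> b" for a b :: real
  proof -
    have "2 * ln (b / a) * (b - a) \<le> (b / a - 1 / (b / a)) * (b - a)"
      using that by (intro mult_right_mono two_ln_le) auto
    moreover have "(b / a - 1 / (b / a)) * (b - a) = (a - b)\<^sup>2 / b + (b - a)\<^sup>2 / a"
      using that by (simp add: field_simps power2_eq_square)
    moreover have "2 * ((ln b - ln a) * (b - a)) = 2 * ln (b / a) * (b - a)"
      using that by (simp add: ln_div)
    ultimately show ?thesis by linarith
  qed
  show ?thesis
  proof (cases "a \<le> b")
    case False
    then show ?thesis using *[of b a] assms by (simp add: algebra_simps)
  qed (use * assms in auto)
qed

section \<open>The power entropies\<close>

lemma DERIV_phi_pow:
  assumes "\<alpha> > 1" "x > 0"
  shows "(phi_pow \<alpha> has_real_derivative 1 / (\<alpha> - 1) * (\<alpha> * x powr (\<alpha> - 1) - 1) - 1) (at x)"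
  unfolding phi_pow_def using assms by (auto intro!: derivative_eq_intros has_real_derivative_powr)

lemma DERIV_deriv_phi_pow:
  assumes "\<alpha> > 1" "x > 0"
  shows "((\<lambda>x. 1 / (\<alpha> - 1) * (\<alpha> * x powr (\<alpha> - 1) - 1) - 1) has_real_derivative
    \<alpha> * x powr (\<alpha> - 2)) (at x)"
proof -
  have "((\<lambda>x. 1 / (\<alpha> - 1) * (\<alpha> * x powr (\<alpha> - 1) - 1) - 1) has_real_derivative
      1 / (\<alpha> - 1) * (\<alpha> * ((\<alpha> - 1) * x powr (\<alpha> - 1 - 1)) - 0) - 0) (at x)"
    using assms by (intro DERIV_diff DERIV_cmult DERIV_const has_real_derivative_powr)
  moreover have "1 / (\<alpha> - 1) * (\<alpha> * ((\<alpha> - 1) * z) - 0) - 0 = \<alpha> * z" for z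
    using assms by simp
  ultimately show ?thesis by simp
qed

lemmas smooth_phi_pow = smooth_entropyI[OF DERIV_phi_pow DERIV_deriv_phi_pow]

lemma Phi_phi_pow:
  assumes "\<alpha> > 1" "a > 0" "b > 0"
  shows "Phi (phi_pow \<alpha>) a b = \<alpha> / (\<alpha> - 1) * ((b powr (\<alpha> - 1) - a powr (\<alpha> - 1)) * (b - a))"
proof -
  have "Phi (phi_pow \<alpha>) a b = (1 / (\<alpha> - 1) * (\<alpha> * b powr (\<alpha> - 1) - 1)
      - 1 / (\<alpha> - 1) * (\<alpha> * a powr (\<alpha> - 1) - 1)) * (b - a)"
    using assms by (simp add: Phi_def smooth_phi_pow)
  also have "\<dots> = 1 / (\<alpha> - 1) * \<alpha> * ((b powr (\<alpha> - 1) - a powr (\<alpha> - 1)) * (b - a))"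
    by (simp only: algebra_simps)
  finally show ?thesis by simp
qed

text \<open>The expression is the Hessian at \<open>(a, b)\<close> of the function
  \<open>(a, b) \<mapsto> (b\<^sup>p - a\<^sup>p) (b - a)\<close>, as a quadratic form in \<open>(u, v)\<close>; its determinant is
  nonnegative by Young's inequality \<open>a\<^sup>p b\<^sup>1\<^sup>-\<^sup>p \<le> p a + (1 - p) b\<close>.\<close>

lemma powr_hessian_nonneg:
  fixes a b u v p :: real
  assumes p: "0 < p" "p \<le> 1" and pos: "a > 0" "b > 0"
  shows "0 \<le> p * (p - 1) * (b powr (p - 2) * v\<^sup>2 - a powr (p - 2) * u\<^sup>2) * (b - a)
    + 2 * p * (b powr (p - 1) * v - a powr (p - 1) * u) * (v - u)"
proof -
  define q r where "q = a powr (p - 2)" and "r = b powr (p - 2)"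
  have qr: "q > 0" "r > 0" using pos by (auto simp: q_def r_def)
  have a1: "a powr (p - 1) = q * a" and b1: "b powr (p - 1) = r * b"
    and a2: "a powr p = q * a * a" and b2: "b powr p = r * b * b"
    using pos powr_add[of a "p - 2" 1] powr_add[of b "p - 2" 1]
      powr_add[of a "p - 2" 2] powr_add[of b "p - 2" 2]
    by (auto simp: q_def r_def powr_numeral power2_eq_square)
  have young: "x powr p \<le> y powr (p - 2) * y * (p * x + (1 - p) * y)" if "x > 0" "y > 0" for x y :: real
  proof -
    have "x powr p = (x powr p * y powr (1 - p)) * (y powr (p - 2) * y)"
      using that powr_add[of y "1 - p" "p - 2"] powr_minus[of y 1] by (simp add: field_simps)
    also have "\<dots> \<le> (p * x + (1 - p) * y) * (y powr (p - 2) * y)"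
      using Youngs_inequality_0[of p "1 - p" x y] that p by (intro mult_right_mono) auto
    finally show ?thesis by (simp add: mult_ac)
  qed
  \<comment> \<open>The form equals p (E u^2 - 2 M u v + F v^2).\<close>
  define E F M where "E = q * ((1 - p) * b + (1 + p) * a)"
    and "F = r * ((1 - p) * a + (1 + p) * b)" and "M = q * a + r * b"
  have E: "E > 0" unfolding E_def using qr pos p by (intro mult_pos_pos add_nonneg_pos) auto
  have "q * (q * a * a) \<le> q * (r * b * (p * a + (1 - p) * b))"
    using young[OF pos] qr by (intro mult_left_mono) (auto simp: a2 r_def)
  moreover have "r * (r * b * b) \<le> r * (q * a * (p * b + (1 - p) * a))"
    using young[OF pos(2,1)] qr by (intro mult_left_mono) (auto simp: b2 q_def)
  \<comment> \<open>Exactly what separates E F - M^2 from the slack of the two Young bounds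
    above.\<close>
  moreover have "q * r * (p * (1 - p) * (a - b)\<^sup>2) \<ge> 0"
    using qr p by simp
  ultimately have disc: "M\<^sup>2 \<le> E * F"
    unfolding E_def F_def M_def power2_eq_square by (simp add: algebra_simps)
  have "E * (E * u\<^sup>2 + F * v\<^sup>2 - 2 * M * u * v) = (E * u - M * v)\<^sup>2 + (E * F - M\<^sup>2) * v\<^sup>2"
    by (simp add: power2_eq_square algebra_simps)
  then have "E * (E * u\<^sup>2 + F * v\<^sup>2 - 2 * M * u * v) \<ge> 0"
    using disc by simp
  then have "0 \<le> E * u\<^sup>2 + F * v\<^sup>2 - 2 * M * u * v"
    using E by (simp add: zero_le_mult_iff)
  then have "0 \<le> p * (E * u\<^sup>2 + F * v\<^sup>2 - 2 * M * u * v)"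
    using p by simp
  also have "\<dots> = p * (p - 1) * (r * v\<^sup>2 - q * u\<^sup>2) * (b - a) + 2 * p * (r * b * v - q * a * u) * (v - u)"
    by (simp add: E_def F_def M_def power2_eq_square algebra_simps)
  finally show ?thesis by (simp add: a1 b1 q_def r_def)
qed

text \<open>The second derivative along the line is the form in \<open>powr_hessian_nonneg\<close>.
  With p = \<alpha> - 1 the function is \<open>Phi (phi_pow \<alpha>)\<close> up to a positive
  factor.\<close>

lemma convex_powr_line:
  assumes p: "0 < p" "p \<le> 1"
  shows "convex_on {t. a + t * u > 0 \<and> b + t * v > 0}
    (\<lambda>t. ((b + t * v) powr p - (a + t * u) powr p) * ((b + t * v) - (a + t * u)))"
proof (rule f''_ge0_imp_convex[OF convex_positive_line])
  fix t assume t: "t \<in> {t. a + t * u > 0 \<and> b + t * v > 0}"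
  have D: "((\<lambda>t. (x + t * k) powr q) has_real_derivative q * (x + t * k) powr (q - 1) * k) (at t)"
    if "x + t * k > 0" for x k q
    by (rule DERIV_chain2[where f = "\<lambda>z. z powr q" and g = "\<lambda>t. x + t * k"])
      (use that in \<open>auto intro!: derivative_eq_intros has_real_derivative_powr\<close>)
  have L: "((\<lambda>t. x + t * k) has_real_derivative k) (at t)" for x k
    by (auto intro!: derivative_eq_intros)
  have pos: "a + t * u > 0" "b + t * v > 0"
    using t by auto
  show "((\<lambda>t. ((b + t * v) powr p - (a + t * u) powr p) * ((b + t * v) - (a + t * u)))
    has_real_derivative
      (p * ((b + t * v) powr (p - 1) * v - (a + t * u) powr (p - 1) * u) * ((b + t * v) - (a + t * u))
        + ((b + t * v) powr p - (a + t * u) powr p) * (v - u))) (at t)"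
    by (rule DERIV_cong[OF DERIV_mult'[OF DERIV_diff[OF D[OF pos(2)] D[OF pos(1)]]
            DERIV_diff[OF L L]]])
      (simp add: algebra_simps)
  show "((\<lambda>t. p * ((b + t * v) powr (p - 1) * v - (a + t * u) powr (p - 1) * u)
          * ((b + t * v) - (a + t * u))
        + ((b + t * v) powr p - (a + t * u) powr p) * (v - u)) has_real_derivative
      (p * (p - 1) * ((b + t * v) powr (p - 2) * v\<^sup>2 - (a + t * u) powr (p - 2) * u\<^sup>2)
          * ((b + t * v) - (a + t * u))
        + 2 * p * ((b + t * v) powr (p - 1) * v - (a + t * u) powr (p - 1) * u) * (v - u))) (at t)"
    by (rule DERIV_cong[OF DERIV_add[OF
            DERIV_mult'[OF DERIV_cmult[OF DERIV_diff[OF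
                  DERIV_cmult_right[OF D[OF pos(2)]] DERIV_cmult_right[OF D[OF pos(1)]]]]
              DERIV_diff[OF L L]]
            DERIV_cmult_right[OF DERIV_diff[OF D[OF pos(2)] D[OF pos(1)]]]]])
      (simp add: algebra_simps power2_eq_square)
  show "p * (p - 1) * ((b + t * v) powr (p - 2) * v\<^sup>2 - (a + t * u) powr (p - 2) * u\<^sup>2)
          * ((b + t * v) - (a + t * u))
        + 2 * p * ((b + t * v) powr (p - 1) * v - (a + t * u) powr (p - 1) * u) * (v - u) \<ge> 0"
    by (intro powr_hessian_nonneg p pos)
qed

lemma supported_entropy_phi_pow:
  assumes \<alpha>: "1 < \<alpha>" "\<alpha> \<le> 2"
  shows "supported_entropy (phi_pow \<alpha>)"
proof -
  interpret smooth_entropy "phi_pow \<alpha>" by (rule smooth_phi_pow) (use \<alpha> in auto)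
  show ?thesis
  proof
    have "convex_on {0<..} (phi_pow \<alpha>)"
      by (rule f''_ge0_imp_convex[OF _ DERIV_phi_pow DERIV_deriv_phi_pow]) (use \<alpha> in auto)
    then show "phi_pow \<alpha> x + deriv (phi_pow \<alpha>) x * (y - x) \<le> phi_pow \<alpha> y"
      if "x > 0" "y > 0" for x y
      using that by (rule support_of_convex)
    fix a b x y :: real
    assume pos: "a > 0" "b > 0" "x > 0" "y > 0"
    let ?A = "{t. a + t * (x - a) > 0 \<and> b + t * (y - b) > 0}"
    have "convex_on ?A (\<lambda>t. \<alpha> / (\<alpha> - 1) * (((b + t * (y - b)) powr (\<alpha> - 1)
        - (a + t * (x - a)) powr (\<alpha> - 1)) * ((b + t * (y - b)) - (a + t * (x - a)))))"
      using \<alpha> by (intro convex_on_cmul convex_powr_line) auto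
    then have "convex_on ?A (\<lambda>t. Phi (phi_pow \<alpha>) (a + t * (x - a)) (b + t * (y - b)))"
      by (rule convex_on_eq) (use \<alpha> in \<open>simp add: Phi_phi_pow\<close>)
    then show "Phi (phi_pow \<alpha>) a b + dPhi (phi_pow \<alpha>) a b * (x - a)
        + dPhi (phi_pow \<alpha>) b a * (y - b) \<le> Phi (phi_pow \<alpha>) x y"
      by (rule Phi_support_of_convex) fact+
  qed
qed

text \<open>The difference of the two sides is \<alpha> a (b - a) (a^(\<alpha>-2) - b^(\<alpha>-2)),
  nonnegative because z^(\<alpha>-2) is nonincreasing for \<alpha> \<le> 2.\<close>

lemma dPhi_phi_pow_le:
  assumes \<alpha>: "1 < \<alpha>" "\<alpha> \<le> 2" and pos: "a > 0" "b > 0"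
  shows "dPhi (phi_pow \<alpha>) b a * (a - b) \<le> - \<alpha> * Phi (phi_pow \<alpha>) a b"
proof -
  have *: "z powr (\<alpha> - 1) = z powr (\<alpha> - 2) * z" if "z > 0" for z :: real
    using that powr_add[of z "\<alpha> - 2" 1] by simp
  have "(b - a) * (a powr (\<alpha> - 2) - b powr (\<alpha> - 2)) \<ge> 0"
  proof (cases "a \<le> b")
    case True
    then have "b powr (\<alpha> - 2) \<le> a powr (\<alpha> - 2)"
      using \<alpha> pos by (intro powr_mono2') auto
    with True show ?thesis by simp
  next
    case False
    then have "a powr (\<alpha> - 2) \<le> b powr (\<alpha> - 2)"
      using \<alpha> pos by (intro powr_mono2') auto
    with False show ?thesis by (simp add: mult_nonpos_nonpos)
  qed
  then have "\<alpha> * (a * ((b - a) * (a powr (\<alpha> - 2) - b powr (\<alpha> - 2)))) \<ge> 0"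
    using \<alpha> pos by simp
  moreover have "(\<alpha> - 1) * Phi (phi_pow \<alpha>) a b = \<alpha> * ((b powr (\<alpha> - 1) - a powr (\<alpha> - 1)) * (b - a))"
    using \<alpha> pos by (simp add: Phi_phi_pow)
  moreover have "dPhi (phi_pow \<alpha>) b a * (a - b) =
      - Phi (phi_pow \<alpha>) a b - \<alpha> * b powr (\<alpha> - 2) * (b - a)\<^sup>2"
    using \<alpha> pos
    by (simp add: dPhi_def Phi_def smooth_phi_pow(3) power2_eq_square algebra_simps)
  ultimately show ?thesis
    using pos by (simp add: * power2_eq_square algebra_simps)
qed

section \<open>Gibbs measures and the three inequalities\<close>

text \<open>The weight m(\<eta>) c(\<eta>,\<sigma>) depends only on H(\<eta>) + H(\<sigma>\<eta>),
  and a product of two successive rates only on the energies of the endpoints.\<close>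

lemma commuting_glauber_gibbs:
  fixes H :: "'a::finite \<Rightarrow> real"
  assumes "finite G"
    and inv: "\<And>\<sigma> \<eta>. \<sigma> \<in> G \<Longrightarrow> \<sigma> (\<sigma> \<eta>) = \<eta>"
    and comm: "\<And>\<sigma> \<gamma> \<eta>. \<sigma> \<in> G \<Longrightarrow> \<gamma> \<in> G \<Longrightarrow> \<sigma> (\<gamma> \<eta>) = \<gamma> (\<sigma> \<eta>)"
  shows "commuting_glauber G (glauber_rate \<beta> H) (gibbs \<beta> H)"
proof
  have Z: "partition_function \<beta> H > 0"
    unfolding partition_function_def by (intro sum_pos) auto
  show "gibbs \<beta> H \<eta> > 0" for \<eta>
    using Z by (simp add: gibbs_def)
  show "(\<Sum>\<eta>\<in>UNIV. gibbs \<beta> H \<eta>) = 1"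
    using Z by (simp add: gibbs_def partition_function_def sum_divide_distrib[symmetric])
  show "gibbs \<beta> H (\<sigma> \<eta>) * glauber_rate \<beta> H (\<sigma> \<eta>) \<sigma> = gibbs \<beta> H \<eta> * glauber_rate \<beta> H \<eta> \<sigma>"
    if "\<sigma> \<in> G" for \<sigma> \<eta>
    using inv[OF that, of \<eta>]
    by (simp add: gibbs_def glauber_rate_def nabla_def exp_add[symmetric] algebra_simps)
  show "glauber_rate \<beta> H \<eta> \<gamma> * glauber_rate \<beta> H (\<gamma> \<eta>) \<sigma>
      = glauber_rate \<beta> H \<eta> \<sigma> * glauber_rate \<beta> H (\<sigma> \<eta>) \<gamma>"
    if "\<sigma> \<in> G" "\<gamma> \<in> G" for \<sigma> \<gamma> \<eta>
    using comm[OF that, of \<eta>]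
    by (simp add: glauber_rate_def nabla_def exp_add[symmetric] algebra_simps)
qed (use assms in \<open>auto simp: glauber_rate_def\<close>)

theorem theorem4p1:
  fixes \<beta> :: real
    and H :: "'a::finite \<Rightarrow> real"
    and G :: "('a \<Rightarrow> 'a) set"
    and c :: "'a \<Rightarrow> ('a \<Rightarrow> 'a) \<Rightarrow> real"
  assumes "\<beta> > 0"
    and "finite G"
    and "\<And>\<sigma> \<eta>. \<sigma> \<in> G \<Longrightarrow> \<sigma> (\<sigma> \<eta>) = \<eta>"
    and "\<And>\<sigma> \<gamma> \<eta>. \<sigma> \<in> G \<Longrightarrow> \<gamma> \<in> G \<Longrightarrow> \<sigma> (\<gamma> \<eta>) = \<gamma> (\<sigma> \<eta>)"
    and "c = glauber_rate \<beta> H"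
    and "irreducible_generator (generator G c)"
    and "\<And>\<eta> \<sigma>. \<sigma> \<in> G \<Longrightarrow> kappa G c \<eta> \<sigma> \<ge> 0"
  shows "(\<forall>\<phi>. admissible \<phi> \<longrightarrow> convex_Sobolev G c (gibbs \<beta> H) \<phi> (kappa_inf G c))
    \<and> modified_log_Sobolev G c (gibbs \<beta> H) (kappa_inf G c + 2 * kappa_bar G c)
    \<and> (\<forall>\<alpha>\<in>{1<..2}. Beckner G c (gibbs \<beta> H) \<alpha> (\<alpha> * kappa_inf G c))"
proof (intro conjI allI impI ballI)
  interpret commuting_glauber G c "gibbs \<beta> H"
    unfolding assms(5) by (rule commuting_glauber_gibbs) fact+
  have glauber_entropy: "glauber_entropy G c (gibbs \<beta> H) \<phi>" if "supported_entropy \<phi>" for \<phi>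
    using that commuting_glauber_axioms by (simp add: glauber_entropy_def)
  {
    fix \<phi> assume "admissible \<phi>"
    then interpret glauber_entropy G c "gibbs \<beta> H" \<phi>
      by (intro glauber_entropy supported_entropy_of_admissible)
    show "convex_Sobolev G c (gibbs \<beta> H) \<phi> (kappa_inf G c)"
      by (intro convex_Sobolev_of_rate contraction_rate_kappa_inf assms)
  next
    interpret glauber_entropy G c "gibbs \<beta> H" phi_log
      by (intro glauber_entropy supported_entropy_phi_log)
    have "contraction_rate (kappa_inf G c + 2 * kappa_bar G c)"
    proof (rule contraction_rate_kappa_bar)
      fix a b :: real assume pos: "a > 0" "b > 0"
      \<comment> \<open>This identifies the gap r(a, b) as (a - b)^2 / b.\<close>
      show "dPhi phi_log b a * (a - b) = - Phi phi_log a b - (a - b)\<^sup>2 / b"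
        using pos by (simp add: dPhi_phi_log Phi_phi_log power2_eq_square field_simps)
      show "2 * Phi phi_log a b \<le> (a - b)\<^sup>2 / b + (b - a)\<^sup>2 / a"
        using pos by (simp add: Phi_phi_log two_ln_diff_le)
      show "(a - b)\<^sup>2 / b \<ge> 0"
        using pos by simp
    qed (fact assms)
    then show "modified_log_Sobolev G c (gibbs \<beta> H) (kappa_inf G c + 2 * kappa_bar G c)"
      unfolding modified_log_Sobolev_def by (intro convex_Sobolev_of_rate assms)
  next
    fix \<alpha> :: real assume \<alpha>: "\<alpha> \<in> {1<..2}"
    then interpret glauber_entropy G c "gibbs \<beta> H" "phi_pow \<alpha>"
      by (intro glauber_entropy supported_entropy_phi_pow) auto
    have "contraction_rate (\<alpha> * kappa_inf G c)"
      by (intro contraction_rate_mult dPhi_phi_pow_le assms) (use \<alpha> in auto)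
    then show "Beckner G c (gibbs \<beta> H) \<alpha> (\<alpha> * kappa_inf G c)"
      unfolding Beckner_def by (intro convex_Sobolev_of_rate assms)
  }
qed

end
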